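(* Let $(p_m)_{m\ge1}$ be monic polynomials, $p_m$ of degree $m$ with only nonnegative real roots, and assume the root counting measures $\mu[\![p_m]\!]$ converge weakly to a probability measure $\mu\ne\delta_0$ on $[0,\infty)$. Then $$\nabla^{(m)}\big(\mathcal S^{(m)}_{p_m}\big)(v)\longrightarrow \frac{d}{dv}\big[S_\mu(-v)\big]=-S_\mu'(-v)\qquad(m\to\infty),$$ locally uniformly in $v\in(0,1-\mu(\{0\}))$.
   Context: For a monic $p(x)=\sum_{k=0}^m(-1)^ke_k(p)x^{m-k}$ of degree $m$ with nonnegative roots, $0$ of multiplicity $r$, the finite free $S$ transform is $S^{(m)}_p(-k/m)=\frac{m-k+1}{k}\frac{e_{k-1}(p)}{e_k(p)}$ for $k=1,\dots,m-r$, and its interpolation is $\mathcal S^{(m)}_p(v)=S^{(m)}_p(-\lceil mv\rceil/m)$ for $v\in(0,1-r/m)$. The root counting measure is $\mu[\![p]\!]=\frac1m\sum_{p(z)=0}\delta_z$ (with multiplicity). $\nabla^{(m)}g(v)=m\big(g(v+\tfrac1m)-g(v)\big)$. For a probability measure $\mu\ne\delta_0$ on $[0,\infty)$ with moment transform $\psi_\mu(z)=\int\frac{zx}{1-zx}\mu(dx)$, the free $S$ transform is $S_\mu(z)=\frac{1+z}{z}\psi_\mu^{-1}(z)$ for $z$ near $(-1+\mu(\{0\}),0)$. *)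

theory Defs
  imports "HOL-Probability.Probability" "HOL-Computational_Algebra.Polynomial"
begin

text \<open>Elementary symmetric functions of the roots: p(x) = sum_k (-1)^k e_k(p) x^(m-k), m = degree p.\<close>
definition esym :: "real poly \<Rightarrow> nat \<Rightarrow> real" where
  "esym p k = (-1) ^ k * coeff p (degree p - k)"

text \<open>Finite free S transform: S_p(-k/m) = (m-k+1)/k * e_(k-1)(p) / e_k(p).\<close>
definition finS :: "real poly \<Rightarrow> nat \<Rightarrow> real" where
  "finS p k = (real (degree p) - real k + 1) / real k * esym p (k - 1) / esym p k"

text \<open>Interpolation: calS_p(v) = S_p(-ceil(m v)/m), meaningful for v in (0, 1 - r/m)
  where r = order 0 p; outside that interval the value is irrelevant.\<close>
definition interpS :: "real poly \<Rightarrow> real \<Rightarrow> real" where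
  "interpS p v = finS p (nat \<lceil>real (degree p) * v\<rceil>)"

definition nabla :: "nat \<Rightarrow> (real \<Rightarrow> real) \<Rightarrow> real \<Rightarrow> real" where
  "nabla m g v = real m * (g (v + 1 / real m) - g v)"

definition root_measure :: "real poly \<Rightarrow> real measure" where
  "root_measure p = measure_pmf (pmf_of_multiset (proots p))"

definition weak_conv_to :: "(nat \<Rightarrow> real measure) \<Rightarrow> real measure \<Rightarrow> bool" where
  "weak_conv_to Ms M \<longleftrightarrow>
     (\<forall>f :: real \<Rightarrow> real. continuous_on UNIV f \<and> bounded (range f) \<longrightarrow>
        (\<lambda>n. integral\<^sup>L (Ms n) f) \<longlonglongrightarrow> integral\<^sup>L M f)"

definition psi :: "real measure \<Rightarrow> real \<Rightarrow> real" where
  "psi M z = (\<integral>x. z * x / (1 - z * x) \<partial>M)"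

text \<open>Free S transform S_mu(z) = (1+z)/z * psi_mu^{-1}(z), z in (-1 + mu{0}, 0);
  the inverse is taken on the negative half line, where psi_mu is strictly increasing.\<close>
definition freeS :: "real measure \<Rightarrow> real \<Rightarrow> real" where
  "freeS M z = (1 + z) / z * (THE t. t < 0 \<and> psi M t = z)"

end

theory Submission
  imports Defs "HOL-Computational_Algebra.Fundamental_Theorem_Algebra"
begin

text \<open>
  The sequence \<open>G k = k * finS p k = (m - k + 1) * esym p (k - 1) / esym p k\<close> is convex in \<open>k\<close>:
  it is read off the derivative of \<open>p\<close> of order \<open>m - k\<close>, which again has nonnegative real roots,
  and convexity is the Cauchy--Schwarz inequality for the power sums of its inverse roots.
  A Darroch-type bound shows that the odds \<open>t = esym p (k - 1) / esym p k\<close> satisfy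
  \<open>k - 1 \<le> (\<Sum>i. t * l i / (1 + t * l i)) \<le> k\<close> for the roots \<open>l i\<close>, so weak convergence of the
  root measures makes \<open>G k / m\<close> converge, for \<open>k / m \<longrightarrow> v\<close>, to \<open>(1 - v) * t\<close> with
  \<open>\<psi>\<^sub>\<mu>(-t) = - v\<close>. Since difference quotients of convex functions converging to a
  differentiable limit converge to the derivative, so do the increments of \<open>G\<close>, and \<open>nabla\<close> of
  the interpolated transform is expressed through \<open>G\<close> and these increments.
\<close>


section \<open>Polynomials with nonnegative real roots\<close>

text \<open>Quantifying over complex zeros expresses real-rootedness and nonnegativity at once. The
  zero polynomial is excluded, since every \<open>z\<close> is a zero of it.\<close>

definition nonneg_rooted :: "real poly \<Rightarrow> bool" where
  "nonneg_rooted q \<longleftrightarrow>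
     (\<forall>z. poly (map_poly complex_of_real q) z = 0 \<longrightarrow> Im z = 0 \<and> Re z \<ge> 0)"

lemma map_poly_of_real_add:
  "map_poly complex_of_real (p + q) = map_poly complex_of_real p + map_poly complex_of_real q"
  by (intro poly_eqI) (simp add: coeff_map_poly)

lemma map_poly_of_real_mult:
  "map_poly complex_of_real (p * q) = map_poly complex_of_real p * map_poly complex_of_real q"
  by (intro poly_eqI) (simp add: coeff_map_poly coeff_mult)

lemma map_poly_of_real_prod:
  "map_poly complex_of_real (prod f I) = (\<Prod>i\<in>I. map_poly complex_of_real (f i))"
  by (induction I rule: infinite_finite_induct) (auto simp: map_poly_of_real_mult)

lemma map_poly_of_real_sum:
  "map_poly complex_of_real (sum f I) = (\<Sum>i\<in>I. map_poly complex_of_real (f i))"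
  by (induction I rule: infinite_finite_induct) (auto simp: map_poly_of_real_add)

lemma poly_map_poly_of_real:
  "poly (map_poly complex_of_real p) (complex_of_real x) = complex_of_real (poly p x)"
  by (induction p) (auto simp: map_poly_pCons)

text \<open>Roots are split off one at a time by the fundamental theorem of algebra. Nonnegativity
  at all indices, also beyond the degree, spares later lemmas a range condition.\<close>

lemma nonneg_rooted_factorization:
  assumes "nonneg_rooted q"
  shows "\<exists>l. (\<forall>i. l i \<ge> 0) \<and> q = smult (lead_coeff q) (\<Prod>i<degree q. [:- l i, 1:])"
  using assms
proof (induction "degree q" arbitrary: q)
  case 0
  then show ?case
    by (intro exI[of _ "\<lambda>_. 0"]) (auto elim: degree_eq_zeroE)
next
  case (Suc n)
  let ?Q = "map_poly complex_of_real q"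
  have "degree ?Q = Suc n"
    using Suc by (simp add: degree_map_poly)
  then obtain z where z: "poly ?Q z = 0"
    using fundamental_theorem_of_algebra constant_degree by (metis Zero_not_Suc)
  define a where "a = Re z"
  have "z = complex_of_real a" "a \<ge> 0"
    using Suc.prems z unfolding nonneg_rooted_def a_def by (auto simp: complex_eq_iff)
  then have "poly q a = 0"
    using z by (simp add: poly_map_poly_of_real)
  then obtain s where s: "q = [:- a, 1:] * s"
    by (metis dvdE poly_eq_0_iff_dvd)
  have "s \<noteq> 0"
    using s Suc.hyps by auto
  then have ds: "degree s = n"
    using Suc.hyps s degree_mult_eq[of "[:- a, 1:]" s] by simp
  have lc: "lead_coeff q = lead_coeff s"
    unfolding s by (subst lead_coeff_mult) simp
  have "nonneg_rooted s"
    using Suc.prems unfolding nonneg_rooted_def s map_poly_of_real_mult by simp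
  then obtain l where l: "\<And>i. l i \<ge> 0" "s = smult (lead_coeff s) (\<Prod>i<n. [:- l i, 1:])"
    using Suc.hyps(1)[of s] ds by auto
  define l' where "l' = l(n := a)"
  have "(\<Prod>i<Suc n. [:- l' i, 1:]) = [:- a, 1:] * (\<Prod>i<n. [:- l i, 1:])"
    by (simp add: l'_def)
  then have "smult (lead_coeff s) (\<Prod>i<Suc n. [:- l' i, 1:]) =
      [:- a, 1:] * smult (lead_coeff s) (\<Prod>i<n. [:- l i, 1:])"
    by (simp only: mult_smult_right)
  also have "\<dots> = q"
    using l(2) s by (simp only:)
  finally have "q = smult (lead_coeff s) (\<Prod>i<Suc n. [:- l' i, 1:])"
    by (rule sym)
  then have "q = smult (lead_coeff q) (\<Prod>i<degree q. [:- l' i, 1:])"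
    unfolding lc Suc.hyps(2) .
  moreover have "\<forall>i. l' i \<ge> 0"
    using l(1) \<open>a \<ge> 0\<close> by (simp add: l'_def)
  ultimately show ?case
    by blast
qed

text \<open>Gauss--Lucas: off the half line, the logarithmic derivative \<open>\<Sum>i. 1 / (z - l i)\<close> has
  a nonzero imaginary part or a negative real part.\<close>
lemma nonneg_rooted_pderiv:
  assumes q: "nonneg_rooted q" and deg: "degree q > 0"
  shows "nonneg_rooted (pderiv q)"
proof -
  obtain l where l: "\<And>i. l i \<ge> 0" and qeq: "q = smult (lead_coeff q) (\<Prod>i<degree q. [:- l i, 1:])"
    using nonneg_rooted_factorization[OF q] by blast
  define n c where "n = degree q" and "c = lead_coeff q"
  have c: "c \<noteq> 0"
    using deg by (auto simp: c_def)
  have q': "q = smult c (\<Prod>i<n. [:- l i, 1:])"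
    using qeq by (simp only: n_def c_def)
  have "pderiv q = smult c (\<Sum>i<n. \<Prod>j\<in>{..<n} - {i}. [:- l j, 1:])"
    unfolding q' by (simp add: pderiv_smult pderiv_prod pderiv_pCons)
  then have val: "poly (map_poly complex_of_real (pderiv q)) z =
      complex_of_real c * (\<Sum>i<n. \<Prod>j\<in>{..<n} - {i}. (z - complex_of_real (l j)))" for z
    by (simp add: map_poly_smult map_poly_of_real_sum map_poly_of_real_prod poly_sum poly_prod
        map_poly_pCons)
  show ?thesis
    unfolding nonneg_rooted_def
  proof (intro allI impI, rule ccontr)
    fix z
    assume zero: "poly (map_poly complex_of_real (pderiv q)) z = 0"
      and out: "\<not> (Im z = 0 \<and> 0 \<le> Re z)"
    have nz: "z - complex_of_real (l j) \<noteq> 0" for j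
      using out l[of j] by auto
    have "(\<Prod>j\<in>{..<n} - {i}. (z - complex_of_real (l j))) =
        (\<Prod>j<n. (z - complex_of_real (l j))) * inverse (z - complex_of_real (l i))" if "i < n" for i
      using that nz by (subst (2) prod.remove[of _ i]) (auto simp: field_simps)
    then have "(\<Sum>i<n. \<Prod>j\<in>{..<n} - {i}. (z - complex_of_real (l j))) =
        (\<Prod>j<n. (z - complex_of_real (l j))) * (\<Sum>i<n. inverse (z - complex_of_real (l i)))"
      by (simp add: sum_distrib_left)
    then have s0: "(\<Sum>i<n. inverse (z - complex_of_real (l i))) = 0"
      using zero c nz unfolding val by auto
    \<comment> \<open>Each \<open>inverse (z - l i)\<close> is the conjugate of
      \<open>z - l i\<close> over its squared modulus. So the imaginary part of the sum is
      \<open>- Im z * w\<close>, and the real parts of the terms have the signs of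
      \<open>Re z - l i\<close>.\<close>
    define w where "w = (\<Sum>i<n. 1 / (cmod (z - complex_of_real (l i)))\<^sup>2)"
    have "n > 0"
      using deg by (simp add: n_def)
    have pos: "1 / (cmod (z - complex_of_real (l i)))\<^sup>2 > 0" for i
      using nz[of i] by simp
    have "w > 0"
      unfolding w_def using \<open>n > 0\<close> pos by (intro sum_pos) auto
    have "Im (\<Sum>i<n. inverse (z - complex_of_real (l i))) = - Im z * w"
      by (simp add: w_def Im_sum sum_distrib_left cmod_power2 sum_negf)
    then have "Im z = 0"
      using s0 \<open>w > 0\<close> by auto
    then have "Re z < 0"
      using out by auto
    have "Re (\<Sum>i<n. inverse (z - complex_of_real (l i))) =
        (\<Sum>i<n. (Re z - l i) * (1 / (cmod (z - complex_of_real (l i)))\<^sup>2))"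
      by (simp add: Re_sum cmod_power2)
    also have "\<dots> < (\<Sum>i<n. 0)"
    proof (rule sum_strict_mono)
      show "(Re z - l i) * (1 / (cmod (z - complex_of_real (l i)))\<^sup>2) < 0" for i
        using pos[of i] \<open>Re z < 0\<close> l[of i] by (intro mult_neg_pos) auto
    qed (use \<open>n > 0\<close> in auto)
    finally show False
      using s0 by simp
  qed
qed

lemma nonneg_rooted_higher_pderiv:
  assumes "nonneg_rooted q" "n < degree q \<or> n = 0"
  shows "nonneg_rooted ((pderiv ^^ n) q)"
  using assms(2)
proof (induction n)
  case (Suc n)
  then have "nonneg_rooted ((pderiv ^^ n) q)" "degree ((pderiv ^^ n) q) > 0"
    by (auto simp: degree_higher_pderiv)
  then show ?case
    by (simp add: nonneg_rooted_pderiv)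
qed (use assms in simp)

text \<open>With \<open>s j\<close> the power sums of \<open>y\<close>, this is the Cauchy--Schwarz
  inequality \<open>s 2 ^ 2 \<le> s 1 * s 3\<close> rewritten by Newton's identities.\<close>
lemma coeff_prod_inequality:
  fixes y :: "'i \<Rightarrow> real"
  assumes fin: "finite I" and y: "\<And>i. i \<in> I \<Longrightarrow> y i \<ge> 0"
  defines "E \<equiv> \<Prod>i\<in>I. [:1, y i:]"
  shows "4 * (coeff E 2)\<^sup>2 \<le> (coeff E 1)\<^sup>2 * coeff E 2 + 3 * coeff E 1 * coeff E 3"
proof -
  define s where "s n = (\<Sum>i\<in>I. y i ^ n)" for n
  \<comment> \<open>Newton's identities are proved by adding one factor at a time;
    \<open>coeff E 0 = 1\<close> is carried along because it enters the update of the first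
    coefficient.\<close>
  have "coeff E 0 = 1 \<and> s 1 = coeff E 1 \<and> s 2 = (coeff E 1)\<^sup>2 - 2 * coeff E 2 \<and>
      s 3 = coeff E 1 ^ 3 - 3 * coeff E 1 * coeff E 2 + 3 * coeff E 3"
    unfolding E_def s_def using fin
  proof (induction I rule: finite_induct)
    case (insert i I)
    then show ?case
      by (simp add: eval_nat_numeral algebra_simps)
  qed (simp add: eval_nat_numeral)
  then have e: "s 1 = coeff E 1" "s 2 = (coeff E 1)\<^sup>2 - 2 * coeff E 2"
      "s 3 = coeff E 1 ^ 3 - 3 * coeff E 1 * coeff E 2 + 3 * coeff E 3"
    by auto
  \<comment> \<open>The two vectors are \<open>y i\<close> to the powers 1/2 and 3/2, written with
    \<open>sqrt\<close>.\<close>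
  have "(\<Sum>i\<in>I. sqrt (y i) * (y i * sqrt (y i)))\<^sup>2 \<le>
      (\<Sum>i\<in>I. (sqrt (y i))\<^sup>2) * (\<Sum>i\<in>I. (y i * sqrt (y i))\<^sup>2)"
    by (rule Cauchy_Schwarz_ineq_sum)
  moreover have "sqrt (y i) * (y i * sqrt (y i)) = y i ^ 2" "(sqrt (y i))\<^sup>2 = y i ^ 1"
    "(y i * sqrt (y i))\<^sup>2 = y i ^ 3" if "i \<in> I" for i
    using y[OF that] by (auto simp: power_mult_distrib power2_eq_square power3_eq_cube mult_ac)
  ultimately have "(s 2)\<^sup>2 \<le> s 1 * s 3"
    unfolding s_def by simp
  then show ?thesis
    unfolding e by (simp add: power2_eq_square power3_eq_cube algebra_simps)
qed


section \<open>Elementary symmetric functions\<close>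

text \<open>As a coefficient of the generating polynomial, \<open>esf\<close> gets its recursion and
  its derivative identity from polynomial arithmetic. A general index set allows a single index to
  be deleted.\<close>

definition esf :: "('i \<Rightarrow> real) \<Rightarrow> 'i set \<Rightarrow> nat \<Rightarrow> real" where
  "esf l I k = coeff (\<Prod>i\<in>I. [:1, l i:]) k"

lemma esf_0 [simp]: "esf l I 0 = 1"
  by (induction I rule: infinite_finite_induct) (simp_all add: esf_def)

lemma esf_insert_Suc:
  "finite I \<Longrightarrow> i \<notin> I \<Longrightarrow> esf l (insert i I) (Suc k) = esf l I (Suc k) + l i * esf l I k"
  by (simp add: esf_def)

lemma esf_nonneg:
  assumes "finite I" "\<And>i. l i \<ge> 0"
  shows "esf l I k \<ge> 0"
  using assms(1)
proof (induction I arbitrary: k rule: finite_induct)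
  case empty
  then show ?case by (cases k) (simp_all add: esf_def)
next
  case (insert i I)
  then show ?case
    using assms(2) by (cases k) (simp_all add: esf_insert_Suc)
qed

text \<open>Choosing \<open>k\<close> indices with positive \<open>l i\<close> gives one strictly
  positive product in a sum of nonnegative ones.\<close>

lemma esf_pos:
  assumes "finite I" "\<And>i. l i \<ge> 0" "k \<le> card {i\<in>I. l i > 0}"
  shows "esf l I k > 0"
  using assms(1,3)
proof (induction I arbitrary: k rule: finite_induct)
  case empty
  then show ?case by simp
next
  case (insert i I)
  show ?case
  proof (cases k)
    case (Suc n)
    show ?thesis
    proof (cases "l i = 0")
      case True
      then have "{j \<in> insert i I. l j > 0} = {j \<in> I. l j > 0}"
        by auto
      then show ?thesis
        using insert True Suc by (auto simp: esf_insert_Suc)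
    next
      case False
      then have "l i > 0"
        using assms(2)[of i] by simp
      moreover from this have "{j \<in> insert i I. l j > 0} = insert i {j \<in> I. l j > 0}"
        by auto
      then have "n \<le> card {j \<in> I. l j > 0}"
        using insert Suc by simp
      then have "esf l I n > 0"
        by (rule insert.IH)
      ultimately show ?thesis
        using insert Suc esf_nonneg[of I l k] assms(2) by (simp add: esf_insert_Suc add_nonneg_pos)
    qed
  qed simp
qed

lemma esf_uminus: "finite I \<Longrightarrow> esf (\<lambda>i. - l i) I k = (-1) ^ k * esf l I k"
proof (induction I arbitrary: k rule: finite_induct)
  case empty
  then show ?case by (cases k) (simp_all add: esf_def)
next
  case (insert i I)
  then show ?case
    by (cases k) (simp_all add: esf_insert_Suc algebra_simps)
qed

text \<open>Newton's inequality without binomial constants, in a two-index form that the induction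
  on \<open>I\<close> can carry. Adding a variable \<open>x\<close> makes both sides quadratic in
  \<open>x\<close>; they are compared coefficientwise, and the linear coefficient involves the
  distant indices \<open>a - 1\<close> and \<open>b + 2\<close>.\<close>

lemma esf_log_concave:
  assumes "finite I" "\<And>i. l i \<ge> 0" "a \<le> b"
  shows "esf l I a * esf l I (Suc (Suc b)) \<le> esf l I (Suc a) * esf l I (Suc b)"
  using assms(1,3)
proof (induction I arbitrary: a b rule: finite_induct)
  case empty
  then show ?case by (simp add: esf_def)
next
  case (insert i I)
  define x where "x = l i"
  define e where "e = esf l I"
  have x: "x \<ge> 0" and e: "\<And>k. e k \<ge> 0" and e0: "e 0 = 1"
    using assms(2) insert.hyps(1) by (auto simp: x_def e_def intro!: esf_nonneg)
  have IH: "e a * e (Suc (Suc b)) \<le> e (Suc a) * e (Suc b)" if "a \<le> b" for a b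
    using insert that by (simp add: e_def)
  have step: "esf l (insert i I) (Suc k) = e (Suc k) + x * e k" for k
    using insert by (simp add: esf_insert_Suc x_def e_def)
  show ?case
  proof (cases a)
    case 0
    have "e (Suc (Suc b)) \<le> e (Suc 0) * e (Suc b)"
      using IH[of 0 b] e0 by simp
    moreover have "0 \<le> x * (e (Suc 0) * e b) + x * x * e b"
      using x e by simp
    ultimately show ?thesis
      unfolding 0 step by (simp add: e0 algebra_simps)
  next
    case (Suc a')
    then obtain b' where b: "b = Suc b'"
      using insert by (cases b) auto
    \<comment> \<open>For \<open>a = b\<close> both sides agree; otherwise this is the induction
      hypothesis at \<open>a\<close> and \<open>b - 1\<close>. It is the bridge between the two
      products in the linear coefficient.\<close>
    have "e a * e (Suc b) \<le> e (Suc a) * e b"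
      using IH[of a b'] insert.prems by (cases "a = b") (auto simp: b)
    moreover have "e a' * e (Suc (Suc b)) \<le> e a * e (Suc b)"
      using IH[of a' b] insert.prems Suc by simp
    ultimately have "x * (e a' * e (Suc (Suc b))) \<le> x * (e (Suc a) * e b)"
      using x by (intro mult_left_mono) auto
    moreover have "x * x * (e a' * e (Suc b)) \<le> x * x * (e a * e b)"
      using IH[of a' b'] insert.prems Suc x b by (intro mult_left_mono) auto
    moreover have "e a * e (Suc (Suc b)) \<le> e (Suc a) * e (Suc b)"
      using IH insert.prems by simp
    ultimately have "(e a + x * e a') * (e (Suc (Suc b)) + x * e (Suc b)) \<le>
        (e (Suc a) + x * e a) * (e (Suc b) + x * e b)"
      by (simp add: algebra_simps)
    then show ?thesis
      unfolding step[of "Suc b"] step[of a] step[of b] using step[of a'] by (simp add: Suc)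
  qed
qed

section \<open>Means of independent trials and a Darroch-type bound\<close>

text \<open>Differentiate the generating polynomial: the product rule deletes one index at a
  time.\<close>

lemma Suc_times_esf:
  assumes "finite I"
  shows "real (Suc k) * esf l I (Suc k) = (\<Sum>i\<in>I. l i * esf l (I - {i}) k)"
proof -
  have "real (Suc k) * esf l I (Suc k) = coeff (pderiv (\<Prod>i\<in>I. [:1, l i:])) k"
    by (simp add: coeff_pderiv esf_def)
  also have "\<dots> = (\<Sum>i\<in>I. l i * esf l (I - {i}) k)"
    by (simp add: pderiv_prod coeff_sum esf_def pderiv_pCons mult.commute)
  finally show ?thesis .
qed

text \<open>The expected number of successes of independent trials with odds \<open>t * l i\<close>.\<close>
definition mean_count :: "('i \<Rightarrow> real) \<Rightarrow> 'i set \<Rightarrow> real \<Rightarrow> real" where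
  "mean_count l I t = (\<Sum>i\<in>I. t * l i / (1 + t * l i))"

lemma mean_count_mono:
  assumes "\<And>i. l i \<ge> 0" "0 \<le> s" "s \<le> t"
  shows "mean_count l I s \<le> mean_count l I t"
  unfolding mean_count_def
proof (rule sum_mono)
  fix i
  have "0 \<le> s * l i" "s * l i \<le> t * l i"
    using assms by (auto intro: mult_right_mono)
  then show "s * l i / (1 + s * l i) \<le> t * l i / (1 + t * l i)"
    using frac_le_eq[of "1 + s * l i" "1 + t * l i"] by (simp add: divide_simps) (simp add: algebra_simps)
qed

text \<open>Each term is at most 1 and vanishes when \<open>l i = 0\<close>. Read backwards, a large
  mean forces many positive roots.\<close>

lemma mean_count_le_card_pos:
  assumes "finite I" "\<And>i. l i \<ge> 0" "0 \<le> t"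
  shows "mean_count l I t \<le> card {i\<in>I. l i > 0}"
proof -
  have "mean_count l I t \<le> (\<Sum>i\<in>I. if l i > 0 then 1 else 0)"
    unfolding mean_count_def
  proof (rule sum_mono)
    fix i
    have "0 \<le> t * l i"
      using assms by simp
    then show "t * l i / (1 + t * l i) \<le> (if l i > 0 then 1 else 0)"
      using assms(2)[of i] by (auto simp: field_simps)
  qed
  also have "\<dots> = card {i\<in>I. l i > 0}"
    using assms(1) by (simp add: sum.If_cases Int_def)
  finally show ?thesis .
qed

text \<open>A form of Darroch's theorem: the odds at which \<open>k - 1\<close> and \<open>k\<close> successes are equally likely
  give a mean between \<open>k - 1\<close> and \<open>k\<close>. Both bounds hold term by term in the expansions
  of \<open>k * e\<^sub>k\<close> and \<open>(k - 1) * e\<^sub>k\<^sub>-\<^sub>1\<close> from \<open>Suc_times_esf\<close>, by Newton's inequality for the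
  family without \<open>i\<close>.\<close>
lemma mean_count_esf_ratio:
  fixes l :: "'i \<Rightarrow> real"
  assumes fin: "finite I" and l: "\<And>i. l i \<ge> 0"
    and pos: "esf l I (Suc n) > 0" "esf l I (Suc (Suc n)) > 0"
  defines "r \<equiv> esf l I (Suc n) / esf l I (Suc (Suc n))"
  shows "real (Suc n) \<le> mean_count l I r" and "mean_count l I r \<le> real (Suc (Suc n))"
proof -
  have bounds: "l i * esf l (I - {i}) n / esf l I (Suc n) \<le> r * l i / (1 + r * l i) \<and>
      r * l i / (1 + r * l i) \<le> l i * esf l (I - {i}) (Suc n) / esf l I (Suc (Suc n))"
    if i: "i \<in> I" for i
  proof -
    define x a b c where "x = l i" and "a = esf l (I - {i}) n"
      and "b = esf l (I - {i}) (Suc n)" and "c = esf l (I - {i}) (Suc (Suc n))"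
    have nn: "x \<ge> 0" "a \<ge> 0" "b \<ge> 0" "c \<ge> 0"
      using l fin by (auto simp: x_def a_def b_def c_def intro!: esf_nonneg)
    have I: "I = insert i (I - {i})"
      using i by auto
    have u: "esf l I (Suc n) = b + x * a" and v: "esf l I (Suc (Suc n)) = c + x * b"
      using fin by (subst I; simp add: esf_insert_Suc a_def b_def c_def x_def del: insert_Diff_single)+
    have ac: "a * c \<le> b * b"
      unfolding a_def b_def c_def using fin l by (intro esf_log_concave) auto
    have p: "b + x * a > 0" "c + x * b > 0"
      using pos unfolding u v by auto
    have d: "c + x * b + x * (b + x * a) > 0"
      using p nn by (simp add: add_pos_nonneg)
    have f: "r * l i / (1 + r * l i) = x * (b + x * a) / (c + x * b + x * (b + x * a))"
      unfolding r_def u v x_def[symmetric] using p d by (simp add: divide_simps) (simp add: algebra_simps)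
    \<comment> \<open>After clearing denominators, the two sides differ by exactly
      \<open>b * b - a * c\<close>; in the upper bound below they differ by \<open>x\<close> times
      that quantity.\<close>
    have "a * (c + x * b + x * (b + x * a)) \<le> (b + x * a) * (b + x * a)"
      using ac by (simp add: algebra_simps)
    then have "x * (a * (c + x * b + x * (b + x * a))) \<le> x * ((b + x * a) * (b + x * a))"
      using nn by (rule_tac mult_left_mono)
    then have 1: "x * a / (b + x * a) \<le> x * (b + x * a) / (c + x * b + x * (b + x * a))"
      using p d by (simp add: divide_simps mult_ac)
    have "x * (a * c) \<le> x * (b * b)"
      using ac nn by (rule_tac mult_left_mono)
    then have "(b + x * a) * (c + x * b) \<le> b * (c + x * b + x * (b + x * a))"
      by (simp add: algebra_simps)
    then have "x * ((b + x * a) * (c + x * b)) \<le> x * (b * (c + x * b + x * (b + x * a)))"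
      using nn by (rule_tac mult_left_mono)
    then have 2: "x * (b + x * a) / (c + x * b + x * (b + x * a)) \<le> x * b / (c + x * b)"
      using p d by (simp add: divide_simps mult_ac)
    show ?thesis
      unfolding f u v using 1 2 by (simp add: x_def a_def b_def)
  qed
  have "real (Suc n) = (\<Sum>i\<in>I. l i * esf l (I - {i}) n / esf l I (Suc n))"
    using Suc_times_esf[OF fin, of n l] pos by (simp add: sum_divide_distrib[symmetric] field_simps)
  also have "\<dots> \<le> mean_count l I r"
    unfolding mean_count_def using bounds by (intro sum_mono) blast
  finally show "real (Suc n) \<le> mean_count l I r" .
  have "mean_count l I r \<le> (\<Sum>i\<in>I. l i * esf l (I - {i}) (Suc n) / esf l I (Suc (Suc n)))"
    unfolding mean_count_def using bounds by (intro sum_mono) blast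
  also have "\<dots> = real (Suc (Suc n))"
    using Suc_times_esf[OF fin, of "Suc n" l] pos by (simp add: sum_divide_distrib[symmetric] field_simps)
  finally show "mean_count l I r \<le> real (Suc (Suc n))" .
qed

section \<open>Coefficients of polynomials and convexity of the weighted transform\<close>

text \<open>\<open>esym\<close> counts coefficients from the top, so the polynomial is reversed,
  which turns the factors \<open>x - l i\<close> into \<open>1 - l i * x\<close>; the sign in
  \<open>esym\<close> then cancels the one from \<open>esf_uminus\<close>.\<close>

lemma esym_prod:
  assumes "p = (\<Prod>i<m. [:- l i, 1:])" "k \<le> m"
  shows "esym p k = esf l {..<m} k"
proof -
  have deg: "degree p = m"
    unfolding assms(1) by (subst degree_prod_eq_sum_degree) auto
  have "reflect_poly p = (\<Prod>i<m. [:1, - l i:])"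
    unfolding assms(1) reflect_poly_prod
  proof (rule prod.cong)
    show "reflect_poly [:- l i, 1:] = [:1, - l i:]" for i
      by (simp add: reflect_poly_def)
  qed simp
  then have "coeff p (m - k) = esf (\<lambda>i. - l i) {..<m} k"
    using assms(2) deg coeff_reflect_poly[of p k] by (simp add: esf_def)
  then show ?thesis
    by (simp add: esym_def deg esf_uminus flip: mult.assoc power_mult_distrib)
qed

lemma coeff_esym: "k \<le> degree p \<Longrightarrow> coeff p (degree p - k) = (-1) ^ k * esym p k"
  by (simp add: esym_def flip: mult.assoc power_mult_distrib)

lemma Suc_times_finS:
  "real (Suc k) * finS p (Suc k) = (real (degree p) - real k) * esym p k / esym p (Suc k)"
  by (simp add: finS_def del: of_nat_Suc)

text \<open>Convexity of \<open>k \<mapsto> k * finS p k\<close>: the inverse roots \<open>y\<close> of the derivative of order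
  \<open>degree p - k\<close> have elementary symmetric functions proportional to
  \<open>esym p (k - j) / esym p k\<close>.\<close>
lemma finS_convex:
  assumes p: "nonneg_rooted p" and k: "Suc (Suc (Suc n)) \<le> degree p"
    and pos: "\<And>j. j \<le> Suc (Suc (Suc n)) \<Longrightarrow> esym p j > 0"
  shows "2 * (real (Suc (Suc n)) * finS p (Suc (Suc n))) \<le>
    real (Suc n) * finS p (Suc n) + real (Suc (Suc (Suc n))) * finS p (Suc (Suc (Suc n)))"
proof -
  define k d where "k = Suc (Suc (Suc n))" and "d = degree p - k"
  have deg: "degree p = d + k"
    using assms(2) by (simp add: d_def k_def)
  define q where "q = (pderiv ^^ d) p"
  have q: "nonneg_rooted q" and dq: "degree q = k"
    using nonneg_rooted_higher_pderiv[OF p, of d] deg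
    by (auto simp: q_def degree_higher_pderiv k_def)
  have cq: "coeff q j = pochhammer (real (Suc j)) d * ((-1) ^ (k - j) * esym p (k - j))"
    if "j \<le> k" for j
    using coeff_esym[of "k - j" p] that by (simp add: q_def coeff_higher_pderiv deg add.commute)
  \<comment> \<open>A nonzero constant coefficient means that no root of \<open>q\<close> is 0, so
    the inverse roots exist.\<close>
  have cq0: "coeff q 0 \<noteq> 0"
    using pos[of k] by (simp add: cq k_def pochhammer_fact[symmetric])
  obtain u where u: "\<And>i. u i \<ge> 0" and qu: "q = smult (lead_coeff q) (\<Prod>i<k. [:- u i, 1:])"
    using nonneg_rooted_factorization[OF q] dq by metis
  have u0: "u i \<noteq> 0" if "i < k" for i
  proof
    assume "u i = 0"
    then have "poly (\<Prod>i<k. [:- u i, 1:]) 0 = 0"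
      using that by (auto simp: poly_prod)
    then have "poly q 0 = 0"
      by (subst qu) simp
    then show False
      using cq0 by (simp add: poly_0_coeff_0)
  qed
  define y where "y i = inverse (u i)" for i
  have y: "y i \<ge> 0" for i
    using u by (simp add: y_def)
  have "(\<Prod>i<k. [:- u i, 1:]) = (\<Prod>i<k. smult (- u i) [:1, - y i:])"
    by (intro prod.cong) (auto simp: y_def u0)
  also have "\<dots> = smult (\<Prod>i<k. - u i) (\<Prod>i<k. [:1, - y i:])"
    by (rule prod_smult)
  finally have qu': "(\<Prod>i<k. [:- u i, 1:]) = smult (\<Prod>i<k. - u i) (\<Prod>i<k. [:1, - y i:])" .
  define c where "c = lead_coeff q * (\<Prod>i<k. - u i)"
  have qc: "q = smult c (\<Prod>i<k. [:1, - y i:])"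
    using qu unfolding qu' smult_smult c_def .
  have qj: "coeff q j = c * ((-1) ^ j * esf y {..<k} j)" for j
    unfolding qc by (simp add: esf_uminus flip: esf_def)
  have c: "c = coeff q 0"
    using qj[of 0] by simp
  have ineq: "4 * (esf y {..<k} 2)\<^sup>2 \<le>
      (esf y {..<k} 1)\<^sup>2 * esf y {..<k} 2 + 3 * esf y {..<k} 1 * esf y {..<k} 3"
    unfolding esf_def using y by (intro coeff_prod_inequality) auto
  have cpos: "c = fact d * ((-1) ^ k * esym p k)"
    unfolding c by (simp add: cq pochhammer_fact[symmetric])
  \<comment> \<open>Three signs meet here: \<open>(-1) ^ k\<close> from \<open>c\<close>,
    \<open>(-1) ^ j\<close> from the factors \<open>1 - y i * x\<close>, and
    \<open>(-1) ^ (k - j)\<close> from the coefficients of \<open>q\<close>. Their product is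
    1.\<close>
  have sgn: "esf y {..<k} j * (fact d * esym p k) = pochhammer (real (Suc j)) d * esym p (k - j)"
    if "j \<le> k" for j
  proof -
    have "esf y {..<k} j * (fact d * esym p k) = (-1) ^ k * coeff q j * (-1) ^ j"
      unfolding qj cpos by (simp add: algebra_simps flip: power_mult_distrib)
    also have "\<dots> = (-1) ^ k * (-1) ^ (k - j) * (-1) ^ j * (pochhammer (real (Suc j)) d * esym p (k - j))"
      unfolding cq[OF that] by (simp only: mult_ac)
    also have "(-1) ^ k * (-1 :: real) ^ (k - j) * (-1) ^ j = 1"
      using that by (simp add: mult.assoc flip: power_add power_mult_distrib)
    finally show ?thesis
      by simp
  qed
  have poch: "pochhammer (real (Suc 1)) d = (real d + 1) * fact d"
    "pochhammer (real (Suc 2)) d = (real d + 1) * (real d + 2) / 2 * fact d"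
    "pochhammer (real (Suc 3)) d = (real d + 1) * (real d + 2) * (real d + 3) / 6 * fact d"
    by (induction d) (simp_all add: pochhammer_Suc field_simps)
  define e0 e1 e2 e3 where "e0 = esym p k" and "e1 = esym p (Suc (Suc n))"
    and "e2 = esym p (Suc n)" and "e3 = esym p n"
  have e: "e0 > 0" "e1 > 0" "e2 > 0" "e3 > 0"
    using pos by (auto simp: e0_def e1_def e2_def e3_def k_def)
  have sgn': "esf y {..<k} j = pochhammer (real (Suc j)) d * esym p (k - j) / (fact d * e0)"
    if "j \<le> k" for j
    using sgn[OF that] e by (simp add: e0_def eq_divide_eq)
  have cancel: "x * fact d * z / (fact d * e0) = x * z / e0" for x z
    by simp
  have E: "esf y {..<k} 1 = (real d + 1) * e1 / e0" "esf y {..<k} 2 = (real d + 1) * (real d + 2) / 2 * e2 / e0"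
    "esf y {..<k} 3 = (real d + 1) * (real d + 2) * (real d + 3) / 6 * e3 / e0"
    using sgn'[of 1] sgn'[of 2] sgn'[of 3] unfolding poch cancel
    by (simp_all add: k_def e1_def e2_def e3_def)
  define E1 E2 E3 where "E1 = esf y {..<k} 1" and "E2 = esf y {..<k} 2" and "E3 = esf y {..<k} 3"
  have Epos: "E1 > 0" "E2 > 0"
    unfolding E1_def E2_def E using e by auto
  \<comment> \<open>In terms of the inverse roots, the values at the indices \<open>k\<close>,
    \<open>k - 1\<close>, \<open>k - 2\<close> no longer involve the order \<open>d\<close> of the
    derivative.\<close>
  have G: "real k * finS p k = E1" "real (Suc (Suc n)) * finS p (Suc (Suc n)) = 2 * E2 / E1"
    "real (Suc n) * finS p (Suc n) = 3 * E3 / E2"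
  proof -
    have "real k * finS p k = (real d + 1) * e1 / e0"
      "real (Suc (Suc n)) * finS p (Suc (Suc n)) = (real d + 2) * e2 / e1"
      "real (Suc n) * finS p (Suc n) = (real d + 3) * e3 / e2"
      using Suc_times_finS[of "Suc (Suc n)" p] Suc_times_finS[of "Suc n" p] Suc_times_finS[of n p]
      by (simp_all add: deg k_def e0_def e1_def e2_def e3_def)
    moreover have "2 * E2 / E1 = (real d + 2) * e2 / e1" "3 * E3 / E2 = (real d + 3) * e3 / e2"
      unfolding E1_def E2_def E3_def E using e
      by (simp_all add: divide_simps add_nonneg_eq_0_iff)
    ultimately show "real k * finS p k = E1"
      "real (Suc (Suc n)) * finS p (Suc (Suc n)) = 2 * E2 / E1"
      "real (Suc n) * finS p (Suc n) = 3 * E3 / E2"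
      unfolding E1_def E by simp_all
  qed
  have "4 * (E2 * E2) \<le> E1 * E1 * E2 + 3 * E1 * E3"
    using ineq by (simp add: E1_def E2_def E3_def power2_eq_square)
  \<comment> \<open>Division by \<open>E1 * E2\<close>.\<close>
  then have "2 * (2 * E2 / E1) \<le> 3 * E3 / E2 + E1"
    using Epos by (simp add: field_simps)
  then show ?thesis
    using G by (simp add: k_def)
qed


section \<open>Joint convergence, root measures and the free S transform\<close>

text \<open>A joint limit at \<open>v\<close> controls \<open>F m w\<close> for all large
  \<open>m\<close> and all \<open>w\<close> in one neighbourhood of \<open>v\<close>; compactness
  leaves finitely many neighbourhoods.\<close>

lemma uniform_limit_if_jointly_tendsto:
  fixes F :: "nat \<Rightarrow> 'a :: topological_space \<Rightarrow> 'b :: metric_space"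
  assumes K: "compact K"
    and lim: "\<And>v. v \<in> K \<Longrightarrow> ((\<lambda>(m, w). F m w) \<longlongrightarrow> f v) (sequentially \<times>\<^sub>F nhds v)"
  shows "uniform_limit K F f sequentially"
  unfolding uniform_limit_iff
proof (intro allI impI)
  fix \<epsilon> :: real
  assume "\<epsilon> > 0"
  have "\<exists>U P. open U \<and> v \<in> U \<and> eventually P sequentially \<and>
      (\<forall>m w. P m \<longrightarrow> w \<in> U \<longrightarrow> dist (F m w) (f v) < \<epsilon> / 2)" if "v \<in> K" for v
  proof -
    have "\<forall>\<^sub>F x in sequentially \<times>\<^sub>F nhds v. dist (case x of (m, w) \<Rightarrow> F m w) (f v) < \<epsilon> / 2"
      using tendstoD[OF lim[OF that], of "\<epsilon> / 2"] \<open>\<epsilon> > 0\<close> by simp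
    then obtain P Q where PQ: "eventually P sequentially" "eventually Q (nhds v)"
      "\<And>m w. P m \<Longrightarrow> Q w \<Longrightarrow> dist (F m w) (f v) < \<epsilon> / 2"
      unfolding eventually_prod_filter by auto
    then show ?thesis
      unfolding eventually_nhds by blast
  qed
  then obtain U P where U: "\<And>v. v \<in> K \<Longrightarrow> open (U v)" "\<And>v. v \<in> K \<Longrightarrow> v \<in> U v"
    and P: "\<And>v. v \<in> K \<Longrightarrow> eventually (P v) sequentially"
    and close: "\<And>v m w. v \<in> K \<Longrightarrow> P v m \<Longrightarrow> w \<in> U v \<Longrightarrow> dist (F m w) (f v) < \<epsilon> / 2"
    by metis
  \<comment> \<open>The variation of \<open>f\<close> near \<open>v\<close> is controlled by letting
    \<open>m\<close> tend to infinity at a fixed \<open>w\<close>. The limit only gives a weak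
    inequality, which the strict one for \<open>F\<close> makes up for at the end.\<close>
  have close': "dist (f w) (f v) \<le> \<epsilon> / 2" if "v \<in> K" "w \<in> K" "w \<in> U v" for v w
  proof -
    have "filterlim (\<lambda>m. (m, w)) (sequentially \<times>\<^sub>F nhds w) sequentially"
      by (intro filterlim_Pair filterlim_ident tendsto_const)
    from filterlim_compose[OF lim[OF \<open>w \<in> K\<close>] this] have "(\<lambda>m. F m w) \<longlonglongrightarrow> f w"
      by simp
    then have "(\<lambda>m. dist (F m w) (f v)) \<longlonglongrightarrow> dist (f w) (f v)"
      by (intro tendsto_intros)
    moreover have "\<forall>\<^sub>F m in sequentially. dist (F m w) (f v) \<le> \<epsilon> / 2"
      using P[OF \<open>v \<in> K\<close>] by (rule eventually_mono)
        (use close[OF \<open>v \<in> K\<close> _ \<open>w \<in> U v\<close>] in force)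
    ultimately show ?thesis
      by (rule tendsto_upperbound) simp
  qed
  obtain T where T: "T \<subseteq> K" "finite T" "K \<subseteq> (\<Union>v\<in>T. U v)"
    using compactE_image[OF K, of K U] U by blast
  have "\<forall>\<^sub>F m in sequentially. \<forall>v\<in>T. P v m"
    using T P by (subst eventually_ball_finite_distrib) auto
  then show "\<forall>\<^sub>F m in sequentially. \<forall>w\<in>K. dist (F m w) (f w) < \<epsilon>"
  proof (rule eventually_mono, intro ballI)
    fix m w
    assume m: "\<forall>v\<in>T. P v m" and "w \<in> K"
    then obtain v where v: "v \<in> T" "w \<in> U v"
      using T by blast
    then have "dist (F m w) (f v) < \<epsilon> / 2" "dist (f w) (f v) \<le> \<epsilon> / 2"
      using m T \<open>w \<in> K\<close> close close' by blast+
    then show "dist (F m w) (f w) < \<epsilon>"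
      using dist_triangle2[of "F m w" "f w" "f v"] by linarith
  qed
qed

section \<open>Integrals against root measures\<close>

text \<open>Grouping the indices by the value of \<open>l\<close> reproduces the multiplicities of
  the multiset.\<close>

lemma integral_pmf_of_multiset_image:
  fixes l :: "'i \<Rightarrow> 'a" and f :: "'a \<Rightarrow> real"
  assumes I: "finite I" "I \<noteq> {}"
  shows "(\<integral>x. f x \<partial>measure_pmf (pmf_of_multiset (image_mset l (mset_set I)))) =
    (\<Sum>i\<in>I. f (l i)) / card I"
proof -
  define A where "A = image_mset l (mset_set I)"
  have A: "A \<noteq> {#}" "set_mset A = l ` I" "size A = card I"
    using I by (auto simp: A_def mset_set_empty_iff)
  have count: "count A x = card {i\<in>I. l i = x}" for x
  proof -
    have "count A x = (\<Sum>i\<in>l -` {x} \<inter> I. 1)"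
      unfolding A_def count_image_mset using I by (intro sum.cong) auto
    also have "l -` {x} \<inter> I = {i\<in>I. l i = x}"
      by auto
    finally show ?thesis by simp
  qed
  have "(\<integral>x. f x \<partial>measure_pmf (pmf_of_multiset A)) = (\<Sum>x\<in>l ` I. f x * (count A x / size A))"
    using A I by (subst integral_measure_pmf_real[of "l ` I"]) (auto simp: pmf_of_multiset)
  also have "\<dots> = (\<Sum>x\<in>l ` I. f x * count A x) / card I"
    by (simp add: A sum_divide_distrib)
  also have "(\<Sum>x\<in>l ` I. f x * count A x) = (\<Sum>x\<in>l ` I. \<Sum>i\<in>{i\<in>I. l i = x}. f (l i))"
    by (intro sum.cong) (auto simp: count)
  also have "\<dots> = (\<Sum>i\<in>I. f (l i))"
    using I by (intro sum.image_gen[symmetric])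
  finally show ?thesis
    by (simp add: A_def)
qed

lemma proots_prod_linear:
  fixes l :: "'i \<Rightarrow> 'a :: idom"
  shows "finite I \<Longrightarrow> proots (\<Prod>i\<in>I. [:- l i, 1:]) = image_mset l (mset_set I)"
proof (induction I rule: finite_induct)
  case (insert i I)
  have "(\<Prod>i\<in>I. [:- l i, 1:]) \<noteq> 0"
    using insert.hyps by simp
  then have "proots (\<Prod>i\<in>insert i I. [:- l i, 1:]) =
      proots [:- l i, 1:] + proots (\<Prod>i\<in>I. [:- l i, 1:])"
    using insert.hyps by (simp add: proots_mult del: mult_pCons_left)
  then show ?case
    using insert by simp
qed simp

section \<open>The moment transform on the negative half line and its inverse\<close>

text \<open>The counterpart of \<open>mean_count\<close> for a measure, and \<open>psi\<close> on
  the negative half line with both signs flipped.\<close>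

definition mean_transform :: "real measure \<Rightarrow> real \<Rightarrow> real" where
  "mean_transform M t = (\<integral>x. t * x / (1 + t * x) \<partial>M)"

lemma psi_uminus: "psi M (- t) = - mean_transform M t"
proof -
  have "(- t) * x / (1 - (- t) * x) = - (t * x / (1 + t * x))" for x
    by simp
  then show ?thesis
    unfolding psi_def mean_transform_def by simp
qed

locale nonneg_prob = prob_space M for M :: "real measure" +
  assumes sets_M [measurable_cong]: "sets M = sets borel"
    and AE_nonneg: "AE x in M. x \<ge> 0"
begin

text \<open>The divided difference of \<open>mean_transform M\<close>, in a form that also makes
  sense for \<open>s = t\<close>, where it is the derivative.\<close>

definition slope :: "real \<Rightarrow> real \<Rightarrow> real" where
  "slope s t = (\<integral>x. x / ((1 + s * x) * (1 + t * x)) \<partial>M)"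

lemma mean_integrand_bound:
  fixes t x :: real
  assumes "t \<ge> 0" "x \<ge> 0"
  shows "norm (t * x / (1 + t * x)) \<le> 1"
proof -
  have "t * x \<ge> 0"
    using assms by simp
  then show ?thesis
    by (simp add: field_simps)
qed

lemma integrable_mean:
  assumes "t \<ge> 0"
  shows "integrable M (\<lambda>x. t * x / (1 + t * x))"
proof (rule integrable_const_bound[of _ 1])
  show "AE x in M. norm (t * x / (1 + t * x)) \<le> 1"
    using AE_nonneg by eventually_elim (rule mean_integrand_bound[OF assms])
qed simp

lemma slope_integrand_bounds:
  fixes s t x :: real
  assumes "s > 0" "t > 0" "x \<ge> 0"
  shows "0 \<le> x / ((1 + s * x) * (1 + t * x))" "x / ((1 + s * x) * (1 + t * x)) \<le> 1 / t"
proof -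
  have p: "s * x \<ge> 0" "t * x \<ge> 0"
    using assms by auto
  then show "0 \<le> x / ((1 + s * x) * (1 + t * x))"
    using assms by auto
  have "0 \<le> s * x * (t * x)"
    using p by simp
  then show "x / ((1 + s * x) * (1 + t * x)) \<le> 1 / t"
    using p assms by (simp add: divide_simps add_pos_nonneg) (simp add: algebra_simps)
qed

lemma integrable_slope:
  assumes "s > 0" "t > 0"
  shows "integrable M (\<lambda>x. x / ((1 + s * x) * (1 + t * x)))"
proof (rule integrable_const_bound[of _ "1 / t"])
  show "AE x in M. norm (x / ((1 + s * x) * (1 + t * x))) \<le> 1 / t"
    using AE_nonneg
    by eventually_elim (use slope_integrand_bounds[OF assms] in \<open>simp only: real_norm_def abs_of_nonneg\<close>)
qed simp

lemma mean_transform_diff: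
  assumes "s > 0" "t > 0"
  shows "mean_transform M s - mean_transform M t = (s - t) * slope s t"
proof -
  have "mean_transform M s - mean_transform M t =
      (\<integral>x. s * x / (1 + s * x) - t * x / (1 + t * x) \<partial>M)"
    using assms by (simp add: mean_transform_def integrable_mean)
  also have "\<dots> = (\<integral>x. (s - t) * (x / ((1 + s * x) * (1 + t * x))) \<partial>M)"
  proof (rule integral_cong_AE)
    show "AE x in M. s * x / (1 + s * x) - t * x / (1 + t * x) =
        (s - t) * (x / ((1 + s * x) * (1 + t * x)))"
      using AE_nonneg
    proof eventually_elim
      case (elim x)
      then have "s * x \<ge> 0" "t * x \<ge> 0"
        using assms by auto
      then show ?case
        by (simp add: divide_simps add_pos_nonneg) (simp add: algebra_simps)
    qed
  qed simp_all
  also have "\<dots> = (s - t) * slope s t"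
    unfolding slope_def by (rule integral_mult_right_zero)
  finally show ?thesis .
qed

text \<open>The integrands differ by \<open>t - s\<close> times a quotient that is at most
  \<open>1 / t\<^sup>2\<close> for every \<open>x \<ge> 0\<close>, so \<open>M\<close> may have
  heavy tails.\<close>

lemma slope_diff_bound:
  assumes "s > 0" "t > 0"
  shows "\<bar>slope s t - slope t t\<bar> \<le> \<bar>s - t\<bar> * (1 / t\<^sup>2)"
proof -
  have "slope s t - slope t t =
      (\<integral>x. x / ((1 + s * x) * (1 + t * x)) - x / ((1 + t * x) * (1 + t * x)) \<partial>M)"
    using assms by (simp add: slope_def integrable_slope)
  also have "\<bar>\<dots>\<bar> \<le> \<bar>s - t\<bar> * (1 / t\<^sup>2)"
  proof (rule order_trans[OF integral_abs_bound])
    have "(\<integral>x. \<bar>x / ((1 + s * x) * (1 + t * x)) - x / ((1 + t * x) * (1 + t * x))\<bar> \<partial>M) \<le>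
        (\<integral>x. \<bar>s - t\<bar> * (1 / t\<^sup>2) \<partial>M)"
    proof (rule integral_mono_AE)
      show "AE x in M. \<bar>x / ((1 + s * x) * (1 + t * x)) - x / ((1 + t * x) * (1 + t * x))\<bar> \<le>
          \<bar>s - t\<bar> * (1 / t\<^sup>2)"
        using AE_nonneg
      proof eventually_elim
        case (elim x)
        define a b where "a = s * x" and "b = t * x"
        have ab: "a \<ge> 0" "b \<ge> 0"
          using elim assms by (auto simp: a_def b_def)
        have "x / ((1 + a) * (1 + b)) - x / ((1 + b) * (1 + b)) =
            (t - s) * (x\<^sup>2 / ((1 + a) * (1 + b)\<^sup>2))"
          using ab by (simp add: divide_simps add_pos_nonneg power2_eq_square)
            (simp add: a_def b_def algebra_simps)
        moreover have "0 \<le> x\<^sup>2 / ((1 + a) * (1 + b)\<^sup>2)"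
          using ab by simp
        moreover have "x\<^sup>2 / ((1 + a) * (1 + b)\<^sup>2) \<le> 1 / t\<^sup>2"
        proof -
          have "(t * x)\<^sup>2 \<le> (1 + b)\<^sup>2"
            using ab by (intro power_mono) (auto simp: b_def)
          also have "\<dots> \<le> (1 + a) * (1 + b)\<^sup>2"
            using ab by (simp add: algebra_simps)
          finally show ?thesis
            using ab assms by (simp add: divide_simps add_pos_nonneg power_mult_distrib mult_ac)
        qed
        ultimately show ?case
          unfolding a_def[symmetric] b_def[symmetric]
          by (simp only: abs_mult abs_minus_commute[of t s] abs_of_nonneg) (intro mult_left_mono; simp)
      qed
    qed (use assms in \<open>auto intro!: integrable_slope integrable_abs Bochner_Integration.integrable_diff\<close>)
    then show "(\<integral>x. \<bar>x / ((1 + s * x) * (1 + t * x)) - x / ((1 + t * x) * (1 + t * x))\<bar> \<partial>M) \<le>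
        \<bar>s - t\<bar> * (1 / t\<^sup>2)"
      by (simp add: prob_space)
  qed
  finally show ?thesis .
qed

text \<open>The difference quotient equals \<open>slope s t\<close>, so only continuity of
  \<open>slope\<close> in \<open>s\<close> has to be shown; no differentiation under the integral
  occurs.\<close>

lemma has_derivative_mean_transform:
  assumes "t > 0"
  shows "(mean_transform M has_real_derivative slope t t) (at t)"
  unfolding has_field_derivative_iff
proof (rule Lim_transform_eventually)
  have "((\<lambda>s. slope s t - slope t t) \<longlongrightarrow> 0) (at t)"
  proof (rule Lim_null_comparison)
    show "\<forall>\<^sub>F s in at t. norm (slope s t - slope t t) \<le> \<bar>s - t\<bar> * (1 / t\<^sup>2)"
      using eventually_at_in_open'[of "{0<..}" t] assms
      by (auto elim!: eventually_mono intro: slope_diff_bound[OF _ assms, simplified])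
    show "((\<lambda>s. \<bar>s - t\<bar> * (1 / t\<^sup>2)) \<longlongrightarrow> 0) (at t)"
      using assms by (auto intro!: tendsto_eq_intros)
  qed
  then show "((\<lambda>s. slope s t) \<longlongrightarrow> slope t t) (at t)"
    by (simp add: LIM_zero_iff)
  have "\<forall>\<^sub>F s in at t. s \<in> {0<..} - {t}"
    using assms by (intro eventually_at_in_open) auto
  then show "\<forall>\<^sub>F s in at t. slope s t =
      (mean_transform M s - mean_transform M t) / (s - t)"
    by (rule eventually_mono) (use assms in \<open>auto simp: mean_transform_diff\<close>)
qed

text \<open>The integrand vanishes only at 0, so a zero integral would put all mass there.\<close>

lemma slope_pos:
  assumes "t > 0" "measure M {0} < 1"
  shows "slope t t > 0"
proof -
  have nn: "AE x in M. 0 \<le> x / ((1 + t * x) * (1 + t * x))"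
    using AE_nonneg by eventually_elim (use slope_integrand_bounds[OF assms(1) assms(1)] in simp)
  have "slope t t \<noteq> 0"
  proof
    assume "slope t t = 0"
    then have "AE x in M. x / ((1 + t * x) * (1 + t * x)) = 0"
      using integral_nonneg_eq_0_iff_AE[OF integrable_slope[OF assms(1) assms(1)] nn]
      by (simp add: slope_def)
    then have "AE x in M. x \<in> {0}"
      using AE_nonneg
    proof eventually_elim
      case (elim x)
      then show ?case
        using assms by (auto simp: add_nonneg_eq_0_iff)
    qed
    then have "prob {0} = 1"
      by (intro prob_eq_1[THEN iffD2]) (auto simp: sets_M)
    then show False
      using assms by simp
  qed
  moreover have "slope t t \<ge> 0"
    unfolding slope_def by (rule integral_nonneg_AE[OF nn])
  ultimately show ?thesis
    by simp
qed

lemma mean_transform_strict_mono: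
  assumes "0 < s" "s < t" "measure M {0} < 1"
  shows "mean_transform M s < mean_transform M t"
proof (rule DERIV_pos_imp_increasing[OF assms(2)])
  fix x
  assume "s \<le> x"
  then show "\<exists>y. (mean_transform M has_real_derivative y) (at x) \<and> y > 0"
    using assms slope_pos[of x] has_derivative_mean_transform[of x] by auto
qed

text \<open>This and the next lemma give the ends of the range. Sequences suit dominated
  convergence, and the intermediate value theorem needs just one point on each side.\<close>

lemma mean_transform_tendsto_0: "(\<lambda>n. mean_transform M (1 / real (Suc n))) \<longlonglongrightarrow> 0"
proof -
  have "(\<lambda>n. mean_transform M (1 / real (Suc n))) \<longlonglongrightarrow> (\<integral>x. 0 \<partial>M)"
    unfolding mean_transform_def
  proof (rule integral_dominated_convergence[of _ _ _ "\<lambda>_. 1"])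
    show "AE x in M. (\<lambda>n. 1 / real (Suc n) * x / (1 + 1 / real (Suc n) * x)) \<longlonglongrightarrow> 0"
    proof (rule AE_I2)
      fix x
      have u: "(\<lambda>n. 1 / real (Suc n)) \<longlonglongrightarrow> 0"
        using LIMSEQ_Suc[OF lim_1_over_n] by simp
      have "(\<lambda>n. 1 / real (Suc n) * x / (1 + 1 / real (Suc n) * x)) \<longlonglongrightarrow> 0 * x / (1 + 0 * x)"
        by (intro tendsto_divide[OF tendsto_mult tendsto_add[OF _ tendsto_mult]] u tendsto_const) simp
      then show "(\<lambda>n. 1 / real (Suc n) * x / (1 + 1 / real (Suc n) * x)) \<longlonglongrightarrow> 0"
        by simp
    qed
    show "AE x in M. norm (1 / real (Suc n) * x / (1 + 1 / real (Suc n) * x)) \<le> 1" for n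
      using AE_nonneg by eventually_elim (rule mean_integrand_bound; simp)
  qed simp_all
  then show ?thesis
    by simp
qed

lemma mean_transform_tendsto_1: "(\<lambda>n. mean_transform M (real (Suc n))) \<longlonglongrightarrow> 1 - measure M {0}"
proof -
  have "(\<lambda>n. mean_transform M (real (Suc n))) \<longlonglongrightarrow> (\<integral>x. indicator (- {0}) x \<partial>M)"
    unfolding mean_transform_def
  proof (rule integral_dominated_convergence[of _ _ _ "\<lambda>_. 1"])
    show "AE x in M. (\<lambda>n. real (Suc n) * x / (1 + real (Suc n) * x)) \<longlonglongrightarrow> indicator (- {0}) x"
      using AE_nonneg
    proof eventually_elim
      case (elim x)
      show ?case
      proof (cases "x = 0")
        case False
        then have "x > 0"
          using elim by simp
        have u: "(\<lambda>n. 1 / real (Suc n)) \<longlonglongrightarrow> 0"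
          using LIMSEQ_Suc[OF lim_1_over_n] by simp
        have "(\<lambda>n. x / (1 / real (Suc n) + x)) \<longlonglongrightarrow> x / (0 + x)"
          using \<open>x > 0\<close> by (intro tendsto_divide[OF _ tendsto_add] u tendsto_const) simp
        then have "(\<lambda>n. x / (1 / real (Suc n) + x)) \<longlonglongrightarrow> 1"
          using \<open>x > 0\<close> by simp
        moreover have "x / (1 / real (Suc n) + x) = real (Suc n) * x / (1 + real (Suc n) * x)" for n
          using \<open>x > 0\<close> by (simp add: field_simps)
        ultimately show ?thesis
          using False by simp
      qed simp
    qed
    show "AE x in M. norm (real (Suc n) * x / (1 + real (Suc n) * x)) \<le> 1" for n
      using AE_nonneg by eventually_elim (rule mean_integrand_bound; simp)
  qed simp_all
  moreover have "(\<integral>x. indicator (- {0}) x \<partial>M) = measure M (space M - {0})"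
    using sets_eq_imp_space_eq[OF sets_M] by (simp add: Compl_eq_Diff_UNIV)
  moreover have "measure M (space M - {0}) = 1 - measure M {0}"
    using prob_compl[of "{0}"] by (simp add: sets_M)
  ultimately show ?thesis
    by simp
qed

lemma mean_transform_surj:
  assumes "0 < v" "v < 1 - measure M {0}"
  shows "\<exists>t>0. mean_transform M t = v"
proof -
  obtain m where m: "mean_transform M (1 / real (Suc m)) < v"
    using order_tendstoD(2)[OF mean_transform_tendsto_0 assms(1)] eventually_happens by fastforce
  obtain n where n: "mean_transform M (real (Suc n)) > v"
    using order_tendstoD(1)[OF mean_transform_tendsto_1 assms(2)] eventually_happens by fastforce
  have "1 / real (Suc m) \<le> 1" "1 \<le> real (Suc n)"
    by (simp_all add: field_simps)
  then have le: "1 / real (Suc m) \<le> real (Suc n)"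
    by linarith
  have "continuous_on {1 / real (Suc m)..real (Suc n)} (mean_transform M)"
  proof (intro continuous_at_imp_continuous_on ballI)
    fix t
    assume "t \<in> {1 / real (Suc m)..real (Suc n)}"
    moreover have "1 / real (Suc m) > 0"
      by simp
    ultimately have "t > 0"
      by (meson atLeastAtMost_iff less_le_trans)
    then show "isCont (mean_transform M) t"
      by (rule DERIV_isCont[OF has_derivative_mean_transform])
  qed
  then obtain t where "t \<ge> 1 / real (Suc m)" "mean_transform M t = v"
    using IVT'[of "mean_transform M" "1 / real (Suc m)" v "real (Suc n)"] m n le by auto
  moreover from this(1) have "t > 0"
    by (rule less_le_trans[rotated]) simp
  ultimately show ?thesis
    by blast
qed

text \<open>For \<open>v\<close> in the range, \<open>- odds v\<close> is the negative point at
  which \<open>psi M\<close> takes the value \<open>- v\<close>.\<close>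

definition odds :: "real \<Rightarrow> real" where
  "odds v = (THE t. t > 0 \<and> mean_transform M t = v)"

lemma odds_eqI:
  assumes "t > 0" "mean_transform M t = v" "measure M {0} < 1"
  shows "odds v = t"
  unfolding odds_def
proof (rule the_equality)
  fix s
  assume s: "s > 0 \<and> mean_transform M s = v"
  show "s = t"
  proof (rule ccontr)
    assume "s \<noteq> t"
    then consider "s < t" | "t < s"
      by linarith
    then show False
      using mean_transform_strict_mono[of s t] mean_transform_strict_mono[of t s] assms s by cases auto
  qed
qed (use assms in simp)

lemma odds:
  assumes "0 < v" "v < 1 - measure M {0}"
  shows "odds v > 0" "mean_transform M (odds v) = v"
  using mean_transform_surj[OF assms] odds_eqI assms by auto

lemma has_derivative_odds:
  assumes v: "0 < v" "v < 1 - measure M {0}"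
  shows "(odds has_real_derivative inverse (slope (odds v) (odds v))) (at v)"
proof (rule DERIV_inverse_function[of "mean_transform M" _ _ _ 0 "1 - measure M {0}"])
  define t where "t = odds v"
  have t: "t > 0" "mean_transform M t = v" and M0: "measure M {0} < 1"
    using odds[OF v] v by (auto simp: t_def)
  show "(mean_transform M has_real_derivative slope (odds v) (odds v)) (at (odds v))"
    using odds[OF v] by (intro has_derivative_mean_transform)
  show "slope (odds v) (odds v) \<noteq> 0"
    using slope_pos[of "odds v"] odds[OF v] M0 by simp
  \<comment> \<open>The radius \<open>t / 2\<close> keeps the whole interval around \<open>t\<close>
    positive, where \<open>odds\<close> undoes \<open>mean_transform M\<close>.\<close>
  have "isCont odds (mean_transform M t)"
  proof (rule isCont_inverse_function[where d = "t / 2" and f = "mean_transform M"])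
    fix z
    assume "\<bar>z - t\<bar> \<le> t / 2"
    then have "z > 0"
      using t by (simp add: abs_if split: if_splits)
    then show "odds (mean_transform M z) = z" "isCont (mean_transform M) z"
      using odds_eqI M0 DERIV_isCont[OF has_derivative_mean_transform] by auto
  qed (use t in simp)
  then show "isCont odds v"
    using t by simp
qed (use v odds in auto)

text \<open>The sign of \<open>(1 + z) / z\<close> at \<open>z = - v\<close> cancels the sign of the
  inverse \<open>- odds v\<close>.\<close>

lemma freeS_uminus:
  assumes "0 < v" "v < 1 - measure M {0}"
  shows "freeS M (- v) = (1 - v) * odds v / v"
proof -
  have "(THE t. t < 0 \<and> psi M t = - v) = - odds v"
  proof (rule the_equality)
    show "- odds v < 0 \<and> psi M (- odds v) = - v"
      using odds[OF assms] by (simp add: psi_uminus)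
    fix t
    assume "t < 0 \<and> psi M t = - v"
    then have "odds v = - t"
      using psi_uminus[of M "- t"] assms by (intro odds_eqI) auto
    then show "t = - odds v"
      by simp
  qed
  then show ?thesis
    using assms by (simp add: freeS_def)
qed

end


section \<open>The limit of the increments\<close>

text \<open>Increments of a convex sequence increase. So a forward secant bounds the increment at
  its left end from above, and a backward secant bounds the increment at its right end from below.
  The window from \<open>a\<close> to \<open>b\<close> is there because convexity is only available
  on part of the indices.\<close>

lemma convex_seq_increment_bounds:
  fixes G :: "nat \<Rightarrow> real"
  assumes convex: "\<And>i. a \<le> i \<Longrightarrow> Suc (Suc i) \<le> b \<Longrightarrow> 2 * G (Suc i) \<le> G i + G (Suc (Suc i))"
    and a: "a \<le> k"
  shows "k \<le> j \<Longrightarrow> j \<le> b \<Longrightarrow> (real j - real k) * (G (Suc k) - G k) \<le> G j - G k"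
    and "k \<le> j \<Longrightarrow> j < b \<Longrightarrow> G j - G k \<le> (real j - real k) * (G (Suc j) - G j)"
proof -
  have mono: "G (Suc i) - G i \<le> G (Suc j) - G j" if "i \<le> j" "a \<le> i" "j < b" for i j
    using that
  proof (induction j rule: dec_induct)
    case (step j)
    then show ?case
      using convex[of j] by simp
  qed simp
  show "(real j - real k) * (G (Suc k) - G k) \<le> G j - G k" if "k \<le> j" "j \<le> b"
    using that
  proof (induction j rule: dec_induct)
    case (step j)
    then show ?case
      using mono[of k j] a by (simp add: algebra_simps)
  qed simp
  have "G i - G k \<le> (real i - real k) * (G (Suc j) - G j)" if "k \<le> i" "i \<le> j" "j < b" for i j
    using that
  proof (induction i rule: dec_induct)
    case (step i)
    then show ?case
      using mono[of i j] a by (simp add: algebra_simps)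
  qed simp
  then show "k \<le> j \<Longrightarrow> j < b \<Longrightarrow> G j - G k \<le> (real j - real k) * (G (Suc j) - G j)"
    by simp
qed

section \<open>Sampling indices along joint limits\<close>

definition idx :: "nat \<Rightarrow> real \<Rightarrow> nat" where
  "idx m v = nat \<lceil>real m * v\<rceil>"

lemma idx_bounds:
  assumes "v > 0"
  shows "real m * v \<le> real (idx m v)" "real (idx m v) < real m * v + 1"
proof -
  have "0 \<le> \<lceil>real m * v\<rceil>"
    using assms by (simp add: less_le_trans[of "-1" 0])
  then have "real (idx m v) = of_int \<lceil>real m * v\<rceil>"
    by (simp add: idx_def)
  then show "real m * v \<le> real (idx m v)" "real (idx m v) < real m * v + 1"
    by linarith+
qed

text \<open>This turns \<open>nabla\<close> into a forward difference in the index.\<close>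

lemma idx_shift:
  assumes "v > 0" "m > 0"
  shows "idx m (v + 1 / real m) = Suc (idx m v)"
proof -
  have "real m * (v + 1 / real m) = real m * v + 1"
    using assms by (simp add: field_simps)
  moreover have "0 \<le> \<lceil>real m * v\<rceil>"
    using assms by (simp add: less_le_trans[of "-1" 0])
  ultimately show ?thesis
    by (simp add: idx_def nat_add_distrib)
qed

text \<open>Locally uniform convergence near \<open>v\<close> is convergence along this filter.\<close>
abbreviation joint :: "real \<Rightarrow> (nat \<times> real) filter" where
  "joint v \<equiv> sequentially \<times>\<^sub>F nhds v"

lemma tendsto_joint_fst: "(f \<longlongrightarrow> c) sequentially \<Longrightarrow> ((\<lambda>x. f (fst x)) \<longlongrightarrow> c) (joint v)"
  by (rule filterlim_compose[OF _ filterlim_fst])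

lemma eventually_joint_fst: "eventually P sequentially \<Longrightarrow> \<forall>\<^sub>F x in joint v. P (fst x)"
  by (rule eventually_compose_filterlim[OF _ filterlim_fst])

lemma eventually_joint_snd: "eventually P (nhds v) \<Longrightarrow> \<forall>\<^sub>F x in joint v. P (snd x)"
  by (rule eventually_compose_filterlim[OF _ filterlim_snd])

text \<open>Transports limits at \<open>v + h\<close> to the filter at \<open>v\<close>, so that
  both ends of a secant of fixed width are seen along one filter.\<close>

lemma filterlim_joint_shift:
  "filterlim (\<lambda>x. (fst x, snd x + h)) (joint (v + h)) (joint v)"
  by (intro filterlim_Pair filterlim_fst tendsto_add filterlim_snd tendsto_const)

lemma eventually_joint_pos:
  assumes "v > 0"
  shows "\<forall>\<^sub>F x in joint v. fst x > 0 \<and> snd x > 0"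
  using eventually_joint_fst[OF eventually_gt_at_top[of 0]]
    eventually_joint_snd[OF eventually_nhds_in_open[of "{0<..}" v]] assms
  by (auto intro: eventually_conj)

lemma idx_ratio_tendsto:
  assumes "v > 0"
  shows "((\<lambda>x. real (idx (fst x) (snd x)) / real (fst x)) \<longlongrightarrow> v) (joint v)"
proof (rule tendsto_sandwich)
  show "((\<lambda>x. snd x) \<longlongrightarrow> v) (joint v)"
    by (rule filterlim_snd)
  have "((\<lambda>x. snd x + 1 / real (fst x)) \<longlongrightarrow> v + 0) (joint v)"
    by (intro tendsto_add filterlim_snd tendsto_joint_fst[OF lim_1_over_n])
  then show "((\<lambda>x. snd x + 1 / real (fst x)) \<longlongrightarrow> v) (joint v)"
    by simp
  show "\<forall>\<^sub>F x in joint v. snd x \<le> real (idx (fst x) (snd x)) / real (fst x)"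
    using eventually_joint_pos[OF assms]
  proof eventually_elim
    case (elim x)
    then show ?case
      using idx_bounds(1)[of "snd x" "fst x"] by (simp add: field_simps)
  qed
  show "\<forall>\<^sub>F x in joint v. real (idx (fst x) (snd x)) / real (fst x) \<le> snd x + 1 / real (fst x)"
    using eventually_joint_pos[OF assms]
  proof eventually_elim
    case (elim x)
    then show ?case
      using idx_bounds(2)[of "snd x" "fst x"] by (simp add: field_simps)
  qed
qed

lemma idx_shift_ratio_tendsto:
  assumes "v > 0"
  shows "((\<lambda>x. (real (idx (fst x) (snd x)) + c) / real (fst x)) \<longlongrightarrow> v) (joint v)"
proof -
  have "(\<lambda>n. c * (1 / real n)) \<longlonglongrightarrow> c * 0"
    by (intro tendsto_mult tendsto_const lim_1_over_n)
  then have "((\<lambda>x. real (idx (fst x) (snd x)) / real (fst x) + c * (1 / real (fst x))) \<longlongrightarrow> v + c * 0)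
      (joint v)"
    by (intro tendsto_add idx_ratio_tendsto assms tendsto_joint_fst[of "\<lambda>n. c * (1 / real n)"])
  then show ?thesis
    by (simp add: add_divide_distrib)
qed

lemma eventually_idx_ge:
  assumes "v > 0"
  shows "\<forall>\<^sub>F x in joint v. n \<le> idx (fst x) (snd x)"
proof -
  \<comment> \<open>\<open>v / 2\<close> serves as a lower bound for all arguments close to
    \<open>v\<close>.\<close>
  have "eventually (\<lambda>m. real m \<ge> real n / (v / 2)) sequentially"
    by (rule eventually_ge_at_top[THEN eventually_compose_filterlim, OF filterlim_real_sequentially])
  from eventually_joint_fst[OF this]
    eventually_joint_snd[OF eventually_nhds_in_open[of "{v / 2<..}" v]]
  have "\<forall>\<^sub>F x in joint v. real n / (v / 2) \<le> real (fst x) \<and> v / 2 < snd x"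
    using assms by (auto intro: eventually_conj)
  then show ?thesis
  proof eventually_elim
    case (elim x)
    then have "snd x > 0"
      using assms by simp
    have "real n = real n / (v / 2) * (v / 2)"
      using assms by simp
    also have "\<dots> \<le> real (fst x) * snd x"
      using elim assms by (intro mult_mono) auto
    also have "\<dots> \<le> real (idx (fst x) (snd x))"
      using idx_bounds(1)[OF \<open>snd x > 0\<close>] .
    finally show ?case
      by simp
  qed
qed

section \<open>Limits for the given polynomials\<close>

text \<open>Fixing the roots as lists \<open>l m\<close> lets symmetric functions and root measures
  be computed from the same data.\<close>

locale convergent_polys = nonneg_prob M for M +
  fixes p :: "nat \<Rightarrow> real poly" and l :: "nat \<Rightarrow> nat \<Rightarrow> real"
  assumes l: "\<And>m i. l m i \<ge> 0"
    and p_eq: "\<And>m. m \<ge> 1 \<Longrightarrow> p m = (\<Prod>i<m. [:- l m i, 1:])"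
    and rooted: "\<And>m. m \<ge> 1 \<Longrightarrow> nonneg_rooted (p m)"
    and conv: "weak_conv_to (\<lambda>m. root_measure (p m)) M"
begin

lemma degree_p: "m \<ge> 1 \<Longrightarrow> degree (p m) = m"
  unfolding p_eq by (subst degree_prod_eq_sum_degree) auto

lemma mean_count_tendsto:
  assumes "t > 0"
  shows "(\<lambda>m. mean_count (l m) {..<m} t / real m) \<longlonglongrightarrow> mean_transform M t"
proof -
  \<comment> \<open>Weak convergence is tested with functions continuous on the whole line, but
    \<open>t * x / (1 + t * x)\<close> has a pole at \<open>- 1 / t\<close>. Clamping
    \<open>x\<close> at 0 removes it and changes nothing on the nonnegative half line.\<close>
  define f where "f x = t * max 0 x / (1 + t * max 0 x)" for x :: real
  have nn: "t * max 0 x \<ge> 0" for x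
    using assms by simp
  have [measurable]: "f \<in> borel_measurable borel"
    unfolding f_def by measurable
  have "continuous_on UNIV f"
    unfolding f_def using nn by (intro continuous_intros) (auto simp: add_nonneg_eq_0_iff)
  moreover have "bounded (range f)"
    unfolding f_def by (rule boundedI[of _ 1]) (use mean_integrand_bound[of t "max 0 _"] assms in auto)
  ultimately have "(\<lambda>m. integral\<^sup>L (root_measure (p m)) f) \<longlonglongrightarrow> integral\<^sup>L M f"
    using conv by (auto simp: weak_conv_to_def)
  moreover have "integral\<^sup>L M f = mean_transform M t"
    unfolding mean_transform_def
  proof (rule integral_cong_AE)
    show "AE x in M. f x = t * x / (1 + t * x)"
      using AE_nonneg by eventually_elim (simp add: f_def max_def)
  qed simp_all
  moreover have "\<forall>\<^sub>F m in sequentially.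
      integral\<^sup>L (root_measure (p m)) f = mean_count (l m) {..<m} t / real m"
    using eventually_ge_at_top[of 1]
  proof eventually_elim
    case (elim m)
    then have "{..<m} \<noteq> {}"
      by (simp add: lessThan_empty_iff)
    moreover have "f (l m i) = t * l m i / (1 + t * l m i)" for i
      using l[of m i] by (simp add: f_def max_def)
    ultimately show ?case
      using elim integral_pmf_of_multiset_image[where I = "{..<m}" and l = "l m" and f = f]
      by (simp add: root_measure_def p_eq proots_prod_linear mean_count_def)
  qed
  ultimately show ?thesis
    by (simp add: tendsto_cong)
qed

text \<open>With \<open>u\<close> strictly between \<open>v\<close> and the end of the range, the
  mean at \<open>odds u\<close> is about \<open>m * u\<close>, which exceeds
  \<open>idx m w + 1\<close> for \<open>w\<close> near \<open>v\<close>. So there are enough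
  positive roots. The extra index is the one reached by the forward difference.\<close>

lemma eventually_esym_pos:
  assumes v: "0 < v" "v < 1 - measure M {0}"
  shows "\<forall>\<^sub>F x in joint v. Suc (idx (fst x) (snd x)) \<le> fst x \<and>
    (\<forall>j \<le> Suc (idx (fst x) (snd x)). esym (p (fst x)) j = esf (l (fst x)) {..<fst x} j \<and>
      esym (p (fst x)) j > 0)"
proof -
  obtain u where u: "v < u" "u < 1 - measure M {0}"
    using dense[OF v(2)] by blast
  define t where "t = odds u"
  have t: "t > 0" "mean_transform M t = u"
    using odds[of u] u v by (auto simp: t_def)
  have "((\<lambda>x. mean_count (l (fst x)) {..<fst x} t / real (fst x) -
      (real (idx (fst x) (snd x)) + 1) / real (fst x)) \<longlongrightarrow> u - v) (joint v)"
    using tendsto_joint_fst[OF mean_count_tendsto[OF t(1)]] t(2) v(1)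
    by (intro tendsto_diff idx_shift_ratio_tendsto) auto
  then have "\<forall>\<^sub>F x in joint v. 0 < mean_count (l (fst x)) {..<fst x} t / real (fst x) -
      (real (idx (fst x) (snd x)) + 1) / real (fst x)"
    using u by (intro order_tendstoD(1)[of _ "u - v"]) auto
  from this eventually_joint_pos[OF v(1)] show ?thesis
  proof eventually_elim
    case (elim x)
    define m k where "m = fst x" and "k = idx (fst x) (snd x)"
    have m: "m > 0"
      using elim by (simp add: m_def)
    have "real (Suc k) < mean_count (l m) {..<m} t"
      using elim by (simp add: m_def k_def divide_less_cancel add.commute)
    also have "\<dots> \<le> card {i\<in>{..<m}. l m i > 0}"
      using l t by (intro mean_count_le_card_pos) auto
    finally have k: "Suc k \<le> card {i\<in>{..<m}. l m i > 0}"
      by simp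
    also have "\<dots> \<le> m"
      using card_mono[of "{..<m}" "{i\<in>{..<m}. l m i > 0}"] by auto
    finally have km: "Suc k \<le> m" .
    have "esym (p m) j = esf (l m) {..<m} j" "esf (l m) {..<m} j > 0" if "j \<le> Suc k" for j
      using that k km m p_eq[of m] l by (auto intro!: esym_prod esf_pos)
    then show ?case
      using km by (simp add: m_def k_def)
  qed
qed

definition ratio :: "nat \<Rightarrow> nat \<Rightarrow> real" where
  "ratio m k = esym (p m) (k - 1) / esym (p m) k"

text \<open>By the Darroch bound the mean at \<open>ratio m k\<close> lies between
  \<open>k - 1\<close> and \<open>k\<close>. Comparing with the mean at a fixed \<open>t\<close> on
  either side of \<open>odds v\<close> and using monotonicity, pointwise convergence of the means
  suffices.\<close>

lemma ratio_tendsto: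
  assumes v: "0 < v" "v < 1 - measure M {0}"
  shows "((\<lambda>x. ratio (fst x) (idx (fst x) (snd x))) \<longlongrightarrow> odds v) (joint v)"
proof -
  have M0: "measure M {0} < 1"
    using v by simp
  have darroch: "\<forall>\<^sub>F x in joint v. fst x > 0 \<and> ratio (fst x) (idx (fst x) (snd x)) > 0 \<and>
      real (idx (fst x) (snd x)) - 1 \<le>
        mean_count (l (fst x)) {..<fst x} (ratio (fst x) (idx (fst x) (snd x))) \<and>
      mean_count (l (fst x)) {..<fst x} (ratio (fst x) (idx (fst x) (snd x))) \<le>
        real (idx (fst x) (snd x))"
    using eventually_esym_pos[OF v] eventually_idx_ge[OF v(1), of 2] eventually_joint_pos[OF v(1)]
  proof eventually_elim
    case (elim x)
    define m k where "m = fst x" and "k = idx (fst x) (snd x)"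
    \<comment> \<open>The Darroch bound is stated for two consecutive positive indices, hence
      \<open>k \<ge> 2\<close>.\<close>
    then obtain n where n: "k = Suc (Suc n)"
      using elim by (metis Suc_le_D numeral_2_eq_2 Suc_le_mono)
    have e: "esym (p m) j = esf (l m) {..<m} j" "esf (l m) {..<m} j > 0" if "j \<le> Suc k" for j
      using elim that unfolding m_def k_def by force+
    have r: "ratio m k = esf (l m) {..<m} (Suc n) / esf (l m) {..<m} (Suc (Suc n))"
      unfolding ratio_def using e n by simp
    have "real (Suc n) \<le> mean_count (l m) {..<m} (ratio m k)"
      "mean_count (l m) {..<m} (ratio m k) \<le> real (Suc (Suc n))"
      unfolding r using l e n by (intro mean_count_esf_ratio; simp)+
    moreover have "ratio m k > 0"
      unfolding r using e n by simp
    ultimately have "ratio m k > 0 \<and> real k - 1 \<le> mean_count (l m) {..<m} (ratio m k) \<and>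
        mean_count (l m) {..<m} (ratio m k) \<le> real k"
      using n by simp
    then show ?case
      using elim unfolding m_def k_def by simp
  qed
  show ?thesis
  proof (rule order_tendstoI)
    fix a
    assume "a < odds v"
    \<comment> \<open>The maximum with 0 keeps the comparison point positive, as
      \<open>mean_count_tendsto\<close> requires.\<close>
    then obtain t where t: "max a 0 < t" "t < odds v"
      using dense[of "max a 0" "odds v"] odds(1)[OF v] by auto
    have "mean_transform M t < v"
      using mean_transform_strict_mono[of t "odds v"] t odds(2)[OF v] M0 by simp
    moreover have "((\<lambda>x. (real (idx (fst x) (snd x)) + (- 1)) / real (fst x) -
        mean_count (l (fst x)) {..<fst x} t / real (fst x)) \<longlongrightarrow> v - mean_transform M t) (joint v)"
      using t by (intro tendsto_diff idx_shift_ratio_tendsto v tendsto_joint_fst[OF mean_count_tendsto]) simp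
    ultimately have "\<forall>\<^sub>F x in joint v. 0 < (real (idx (fst x) (snd x)) + (- 1)) / real (fst x) -
        mean_count (l (fst x)) {..<fst x} t / real (fst x)"
      by (intro order_tendstoD(1)[of _ "v - mean_transform M t"]) auto
    from this darroch show "\<forall>\<^sub>F x in joint v. a < ratio (fst x) (idx (fst x) (snd x))"
    proof eventually_elim
      case (elim x)
      then have "mean_count (l (fst x)) {..<fst x} t < real (idx (fst x) (snd x)) - 1"
        by (simp add: divide_less_cancel)
      then have "\<not> ratio (fst x) (idx (fst x) (snd x)) \<le> t"
        using elim l mean_count_mono[of "l (fst x)" "ratio (fst x) (idx (fst x) (snd x))" t "{..<fst x}"]
        by auto
      then show ?case
        using t by simp
    qed
  next
    fix t
    assume t: "odds v < t"
    have t0: "t > 0"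
      using t odds(1)[OF v] by simp
    have "v < mean_transform M t"
      using mean_transform_strict_mono[of "odds v" t] t odds[OF v] M0 by simp
    moreover have "((\<lambda>x. mean_count (l (fst x)) {..<fst x} t / real (fst x) -
        real (idx (fst x) (snd x)) / real (fst x)) \<longlongrightarrow> mean_transform M t - v) (joint v)"
      using t0 by (intro tendsto_diff idx_ratio_tendsto v tendsto_joint_fst[OF mean_count_tendsto])
    ultimately have "\<forall>\<^sub>F x in joint v. 0 < mean_count (l (fst x)) {..<fst x} t / real (fst x) -
        real (idx (fst x) (snd x)) / real (fst x)"
      by (intro order_tendstoD(1)[of _ "mean_transform M t - v"]) auto
    from this darroch show "\<forall>\<^sub>F x in joint v. ratio (fst x) (idx (fst x) (snd x)) < t"
    proof eventually_elim
      case (elim x)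
      then have "real (idx (fst x) (snd x)) < mean_count (l (fst x)) {..<fst x} t"
        by (simp add: divide_less_cancel)
      then have "\<not> t \<le> ratio (fst x) (idx (fst x) (snd x))"
        using elim l t0
          mean_count_mono[of "l (fst x)" t "ratio (fst x) (idx (fst x) (snd x))" "{..<fst x}"]
        by auto
      then show ?case
        by simp
    qed
  qed
qed

definition G :: "nat \<Rightarrow> nat \<Rightarrow> real" where
  "G m k = real k * finS (p m) k"

text \<open>The limit of \<open>G m k / m\<close>; on the interval it equals
  \<open>v * freeS M (- v)\<close>.\<close>

definition g :: "real \<Rightarrow> real" where
  "g v = (1 - v) * odds v"

lemma G_tendsto:
  assumes v: "0 < v" "v < 1 - measure M {0}"
  shows "((\<lambda>x. G (fst x) (idx (fst x) (snd x)) / real (fst x)) \<longlongrightarrow> g v) (joint v)"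
proof -
  have "((\<lambda>x. (1 - (real (idx (fst x) (snd x)) + (- 1)) / real (fst x)) *
      ratio (fst x) (idx (fst x) (snd x))) \<longlongrightarrow> g v) (joint v)"
    unfolding g_def
    by (intro tendsto_mult tendsto_diff tendsto_const idx_shift_ratio_tendsto ratio_tendsto v)
  moreover have "\<forall>\<^sub>F x in joint v. (1 - (real (idx (fst x) (snd x)) + (- 1)) / real (fst x)) *
      ratio (fst x) (idx (fst x) (snd x)) = G (fst x) (idx (fst x) (snd x)) / real (fst x)"
    using eventually_idx_ge[OF v(1), of 1] eventually_joint_pos[OF v(1)]
  proof eventually_elim
    case (elim x)
    define m k where "m = fst x" and "k = idx (fst x) (snd x)"
    have mk: "m > 0" "k \<ge> 1"
      using elim by (auto simp: m_def k_def)
    then have "G m k = (real m - real k + 1) * ratio m k"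
      by (simp add: G_def finS_def degree_p ratio_def)
    then have "(1 - (real k + (- 1)) / real m) * ratio m k = G m k / real m"
      using mk by (simp add: field_simps)
    then show ?case
      unfolding m_def k_def .
  qed
  ultimately show ?thesis
    by (rule Lim_transform_eventually)
qed

text \<open>Convexity starts at index 1, because \<open>G m 0\<close> is 0 by convention and does
  not belong to the convex sequence.\<close>

lemma G_convex:
  assumes "m \<ge> 1" "b \<le> m" "\<And>j. j \<le> b \<Longrightarrow> esym (p m) j > 0" "1 \<le> i" "Suc (Suc i) \<le> b"
  shows "2 * G m (Suc i) \<le> G m i + G m (Suc (Suc i))"
proof -
  obtain n where "i = Suc n"
    using assms by (cases i) auto
  then show ?thesis
    unfolding G_def using assms by (simp only: finS_convex rooted degree_p)
qed

text \<open>The width \<open>h\<close> is fixed first, so that the secant of \<open>g\<close> is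
  close to \<open>g'\<close>; only then does \<open>m\<close> grow and the secants of
  \<open>G\<close> approach that of \<open>g\<close>. Positive \<open>h\<close> gives the upper
  bound, negative \<open>h\<close> the lower one.\<close>

lemma G_increment_tendsto:
  assumes v: "0 < v" "v < 1 - measure M {0}" and g': "(g has_real_derivative g') (at v)"
  shows "((\<lambda>x. G (fst x) (Suc (idx (fst x) (snd x))) - G (fst x) (idx (fst x) (snd x))) \<longlongrightarrow> g')
    (joint v)"
proof -
  \<comment> \<open>Numerator and denominator are both divided by \<open>m\<close>, so that each has
    a limit; \<open>Q_eq\<close> removes the scaling.\<close>
  define Q where "Q h x = (G (fst x) (idx (fst x) (snd x + h)) / real (fst x) -
      G (fst x) (idx (fst x) (snd x)) / real (fst x)) /
      (real (idx (fst x) (snd x + h)) / real (fst x) - real (idx (fst x) (snd x)) / real (fst x))"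
    for h and x :: "nat \<times> real"
  have Q: "(Q h \<longlongrightarrow> (g (v + h) - g v) / h) (joint v)" and
    gap: "((\<lambda>x. real (idx (fst x) (snd x + h)) / real (fst x) - real (idx (fst x) (snd x)) / real (fst x))
      \<longlongrightarrow> h) (joint v)"
    if h: "h \<noteq> 0" "0 < v + h" "v + h < 1 - measure M {0}" for h
  proof -
    have i: "((\<lambda>x. real (idx (fst x) (snd x + h)) / real (fst x)) \<longlongrightarrow> v + h) (joint v)"
      using filterlim_compose[OF idx_ratio_tendsto[OF h(2)] filterlim_joint_shift] by simp
    have G: "((\<lambda>x. G (fst x) (idx (fst x) (snd x + h)) / real (fst x)) \<longlongrightarrow> g (v + h)) (joint v)"
      using filterlim_compose[OF G_tendsto[OF h(2,3)] filterlim_joint_shift] by simp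
    show gap: "((\<lambda>x. real (idx (fst x) (snd x + h)) / real (fst x) - real (idx (fst x) (snd x)) / real (fst x))
      \<longlongrightarrow> h) (joint v)"
      using tendsto_diff[OF i idx_ratio_tendsto[OF v(1)]] by simp
    show "(Q h \<longlongrightarrow> (g (v + h) - g v) / h) (joint v)"
      unfolding Q_def using h by (intro tendsto_divide[OF tendsto_diff gap] G G_tendsto v)
  qed
  have Q_eq: "Q h x = (G (fst x) (idx (fst x) (snd x + h)) - G (fst x) (idx (fst x) (snd x))) /
      (real (idx (fst x) (snd x + h)) - real (idx (fst x) (snd x)))" if "fst x > 0" for h x
    using that by (simp add: Q_def flip: diff_divide_distrib)
  have diff: "((\<lambda>h. (g (v + h) - g v) / h) \<longlongrightarrow> g') (at 0)"
    using g' by (simp add: DERIV_def)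
  show ?thesis
  proof (rule order_tendstoI)
    fix b
    assume "g' < b"
    then have "\<forall>\<^sub>F h in at_right 0. (g (v + h) - g v) / h < b"
      using order_tendstoD(2)[OF tendsto_within_subset[OF diff, of "{0<..}"]] by simp
    moreover have "\<forall>\<^sub>F h in at_right 0. h \<in> {0<..<1 - measure M {0} - v}"
      using v by (intro eventually_at_right_real) simp
    ultimately obtain h where h: "(g (v + h) - g v) / h < b" "h > 0" "v + h < 1 - measure M {0}"
      using eventually_happens[OF eventually_conj] by fastforce
    have h': "h \<noteq> 0" "0 < v + h"
      using h v by auto
    \<comment> \<open>Positivity at the right end \<open>v + h\<close> covers every index of the
      secant.\<close>
    have "\<forall>\<^sub>F x in joint v. Suc (idx (fst x) (snd x + h)) \<le> fst x \<and>
        (\<forall>j \<le> Suc (idx (fst x) (snd x + h)). esym (p (fst x)) j > 0)"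
      using eventually_compose_filterlim[OF eventually_esym_pos[OF h'(2) h(3)] filterlim_joint_shift]
      by (auto elim: eventually_mono)
    from this eventually_idx_ge[OF v(1), of 1] order_tendstoD(1)[OF gap[OF h' h(3)] h(2)]
      order_tendstoD(2)[OF Q[OF h' h(3)] h(1)] eventually_joint_pos[OF v(1)]
    show "\<forall>\<^sub>F x in joint v. G (fst x) (Suc (idx (fst x) (snd x))) - G (fst x) (idx (fst x) (snd x)) < b"
    proof eventually_elim
      case (elim x)
      define m k j where "m = fst x" and "k = idx (fst x) (snd x)" and "j = idx (fst x) (snd x + h)"
      have m: "m \<ge> 1" and k: "1 \<le> k" and j: "Suc j \<le> m" "\<And>i. i \<le> Suc j \<Longrightarrow> esym (p m) i > 0"
        using elim by (auto simp: m_def k_def j_def)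
      have "real k / real m < real j / real m"
        using elim by (simp add: m_def k_def j_def)
      then have kj: "k < j"
        using m by (simp add: divide_less_cancel)
      have "(real j - real k) * (G m (Suc k) - G m k) \<le> G m j - G m k"
        using kj k m j by (intro convex_seq_increment_bounds(1)[of 1 j] G_convex[of m j]) auto
      then have "G m (Suc k) - G m k \<le> (G m j - G m k) / (real j - real k)"
        using kj by (simp add: field_simps)
      also have "\<dots> < b"
        using elim by (simp add: Q_eq m_def k_def j_def)
      finally show ?case
        by (simp add: m_def k_def)
    qed
  next
    fix b
    assume "b < g'"
    then have "\<forall>\<^sub>F h in at_left 0. (g (v + h) - g v) / h > b"
      using order_tendstoD(1)[OF tendsto_within_subset[OF diff, of "{..<0}"]] by simp
    moreover have "\<forall>\<^sub>F h in at_left 0. h \<in> {- v<..<0}"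
      using v by (intro eventually_at_left_real) simp
    ultimately obtain h where h: "(g (v + h) - g v) / h > b" "h < 0" "0 < v + h"
      using eventually_happens[OF eventually_conj] by fastforce
    have h': "h \<noteq> 0" "v + h < 1 - measure M {0}"
      using h v by auto
    \<comment> \<open>Here the left end lies at \<open>v + h\<close>, so it is this index that must
      stay in the range of \<open>G_convex\<close>.\<close>
    have "\<forall>\<^sub>F x in joint v. 1 \<le> idx (fst x) (snd x + h)"
      using eventually_compose_filterlim[OF eventually_idx_ge[OF h(3), of 1] filterlim_joint_shift]
      by simp
    from this eventually_esym_pos[OF v] order_tendstoD(2)[OF gap[OF h'(1) h(3) h'(2)] h(2)]
      order_tendstoD(1)[OF Q[OF h'(1) h(3) h'(2)] h(1)] eventually_joint_pos[OF v(1)]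
    show "\<forall>\<^sub>F x in joint v. b < G (fst x) (Suc (idx (fst x) (snd x))) - G (fst x) (idx (fst x) (snd x))"
    proof eventually_elim
      case (elim x)
      define m k j where "m = fst x" and "k = idx (fst x) (snd x)" and "j = idx (fst x) (snd x + h)"
      have m: "m \<ge> 1" and j: "1 \<le> j" and k: "Suc k \<le> m" "\<And>i. i \<le> Suc k \<Longrightarrow> esym (p m) i > 0"
        using elim by (auto simp: m_def k_def j_def)
      have "real j / real m < real k / real m"
        using elim by (simp add: m_def k_def j_def)
      then have jk: "j < k"
        using m by (simp add: divide_less_cancel)
      \<comment> \<open>The window reaches \<open>Suc k\<close>, since the increment at
        \<open>k\<close> involves that term.\<close>
      have "G m k - G m j \<le> (real k - real j) * (G m (Suc k) - G m k)"
        using jk k m j by (intro convex_seq_increment_bounds(2)[of 1 "Suc k"] G_convex[of m "Suc k"]) auto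
      then have "(G m k - G m j) / (real k - real j) \<le> G m (Suc k) - G m k"
        using jk by (simp add: field_simps)
      moreover have "(G m j - G m k) / (real j - real k) = (G m k - G m j) / (real k - real j)"
        using jk by (simp add: field_simps)
      moreover have "b < (G m j - G m k) / (real j - real k)"
        using elim by (simp add: Q_eq m_def k_def j_def)
      ultimately show ?case
        by (simp add: m_def k_def)
    qed
  qed
qed

lemma has_derivative_g:
  assumes "0 < v" "v < 1 - measure M {0}"
  obtains g' where "(g has_real_derivative g') (at v)"
  using DERIV_mult[OF DERIV_diff[OF DERIV_const[of 1] DERIV_ident] has_derivative_odds[OF assms]]
  unfolding g_def by blast

text \<open>Quotient rule for \<open>g w / w\<close>, which agrees with \<open>freeS M (- w)\<close>
  only on the open interval.\<close>

lemma has_derivative_freeS: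
  assumes v: "0 < v" "v < 1 - measure M {0}" and g': "(g has_real_derivative g') (at v)"
  shows "((\<lambda>w. freeS M (- w)) has_real_derivative (g' * v - g v) / (v * v)) (at v)"
proof (rule has_field_derivative_transform_within_open)
  show "((\<lambda>w. g w / w) has_real_derivative (g' * v - g v) / (v * v)) (at v)"
    using DERIV_divide[OF g' DERIV_ident] v by simp
  show "v \<in> {0<..<1 - measure M {0}}"
    using v by simp
qed (auto simp: freeS_uminus g_def)

text \<open>A discrete quotient rule: with \<open>A = k / m\<close> and
  \<open>B = (k + 1) / m\<close>, the forward difference of \<open>G m k / k\<close> times
  \<open>m\<close> is the increment of \<open>G\<close> over \<open>B\<close>, minus
  \<open>G m k / m\<close> over \<open>A * B\<close>. Both \<open>A\<close> and \<open>B\<close>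
  tend to \<open>v\<close>.\<close>

lemma nabla_tendsto:
  assumes v: "0 < v" "v < 1 - measure M {0}"
  shows "((\<lambda>(m, w). nabla m (interpS (p m)) w) \<longlongrightarrow> deriv (\<lambda>w. freeS M (- w)) v) (joint v)"
proof -
  obtain g' where g': "(g has_real_derivative g') (at v)"
    using has_derivative_g[OF v] .
  define A B where "A x = real (idx (fst x) (snd x)) / real (fst x)"
    and "B x = (real (idx (fst x) (snd x)) + 1) / real (fst x)" for x :: "nat \<times> real"
  have "((\<lambda>x. (G (fst x) (Suc (idx (fst x) (snd x))) - G (fst x) (idx (fst x) (snd x))) / B x -
      G (fst x) (idx (fst x) (snd x)) / real (fst x) / (A x * B x)) \<longlongrightarrow> g' / v - g v / (v * v)) (joint v)"
    unfolding A_def B_def using v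
    by (intro tendsto_diff tendsto_divide[OF G_increment_tendsto[OF v g'] idx_shift_ratio_tendsto]
        tendsto_divide[OF G_tendsto tendsto_mult] idx_shift_ratio_tendsto idx_ratio_tendsto) auto
  moreover have "\<forall>\<^sub>F x in joint v.
      (G (fst x) (Suc (idx (fst x) (snd x))) - G (fst x) (idx (fst x) (snd x))) / B x -
      G (fst x) (idx (fst x) (snd x)) / real (fst x) / (A x * B x) =
      (case x of (m, w) \<Rightarrow> nabla m (interpS (p m)) w)"
    using eventually_joint_pos[OF v(1)] eventually_idx_ge[OF v(1), of 1]
  proof eventually_elim
    case (elim x)
    define m w k where "m = fst x" and "w = snd x" and "k = idx (fst x) (snd x)"
    have m: "m \<ge> 1" and w: "w > 0" and k: "real k > 0"
      using elim by (auto simp: m_def w_def k_def)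
    have "nabla m (interpS (p m)) w = real m * (finS (p m) (Suc k) - finS (p m) k)"
      using m w idx_shift[of w m] by (simp add: nabla_def interpS_def degree_p k_def m_def w_def idx_def)
    also have "\<dots> = real m * (G m (Suc k) / (real k + 1) - G m k / real k)"
      using k by (simp add: G_def add.commute)
    also have "\<dots> = (G m (Suc k) - G m k) / ((real k + 1) / real m) -
        G m k / real m / (real k / real m * ((real k + 1) / real m))"
      using m k by (simp add: divide_simps) (simp add: algebra_simps)
    finally show ?case
      by (simp add: A_def B_def m_def k_def w_def case_prod_unfold)
  qed
  ultimately have "((\<lambda>(m, w). nabla m (interpS (p m)) w) \<longlongrightarrow> g' / v - g v / (v * v)) (joint v)"
    by (rule Lim_transform_eventually)
  moreover have "g' / v - g v / (v * v) = deriv (\<lambda>w. freeS M (- w)) v"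
    using DERIV_imp_deriv[OF has_derivative_freeS[OF v g']] v by (simp add: field_simps)
  ultimately show ?thesis
    by simp
qed

end

section \<open>From joint convergence to local uniformity\<close>

theorem mainTheorem10:
  fixes p :: "nat \<Rightarrow> real poly" and \<mu> :: "real measure"
  assumes monic: "\<And>m. m \<ge> 1 \<Longrightarrow> lead_coeff (p m) = 1"
    and deg: "\<And>m. m \<ge> 1 \<Longrightarrow> degree (p m) = m"
    and roots: "\<And>m z. m \<ge> 1 \<Longrightarrow> poly (map_poly complex_of_real (p m)) z = 0 \<Longrightarrow>
                   Im z = 0 \<and> Re z \<ge> 0"
    and prob: "prob_space \<mu>" and sets: "sets \<mu> = sets borel"
    and supp: "emeasure \<mu> {..<0} = 0"
    and nondeg: "\<mu> \<noteq> return borel 0"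
    and conv: "weak_conv_to (\<lambda>m. root_measure (p m)) \<mu>"
  shows "(\<forall>v \<in> {0<..<1 - measure \<mu> {0}}. (\<lambda>w. freeS \<mu> (- w)) differentiable (at v)) \<and>
         (\<forall>K. compact K \<longrightarrow> K \<subseteq> {0<..<1 - measure \<mu> {0}} \<longrightarrow>
            uniform_limit K (\<lambda>m v. nabla m (interpS (p m)) v)
              (\<lambda>v. deriv (\<lambda>w. freeS \<mu> (- w)) v) sequentially)"
proof -
  have rooted: "nonneg_rooted (p m)" if "m \<ge> 1" for m
    using roots[OF that] by (auto simp: nonneg_rooted_def)
  \<comment> \<open>The implication makes the choice total: at \<open>m = 0\<close> any nonnegative
    list serves.\<close>
  have "\<exists>l. (\<forall>i. l i \<ge> 0) \<and> (m \<ge> 1 \<longrightarrow> p m = (\<Prod>i<m. [:- l i, 1:]))" for m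
  proof (cases "m \<ge> 1")
    case True
    then show ?thesis
      using nonneg_rooted_factorization[OF rooted] monic deg by (metis smult_1_left)
  qed auto
  then obtain l where l: "\<And>m i. l m i \<ge> 0" "\<And>m. m \<ge> 1 \<Longrightarrow> p m = (\<Prod>i<m. [:- l m i, 1:])"
    by metis
  interpret prob_space \<mu>
    by (rule prob)
  have "AE x in \<mu>. x \<ge> 0"
    by (rule AE_I[of _ _ "{..<0}"]) (auto simp: supp sets)
  then interpret convergent_polys \<mu> p l
    using sets l rooted conv by unfold_locales auto
  show ?thesis
  proof (intro conjI allI impI ballI)
    fix v
    assume "v \<in> {0<..<1 - measure \<mu> {0}}"
    then have v: "0 < v" "v < 1 - measure \<mu> {0}"
      by auto
    obtain g' where "(g has_real_derivative g') (at v)"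
      using has_derivative_g[OF v] .
    from has_derivative_freeS[OF v this] show "(\<lambda>w. freeS \<mu> (- w)) differentiable (at v)"
      using real_differentiable_def by blast
  next
    fix K
    assume "compact K" "K \<subseteq> {0<..<1 - measure \<mu> {0}}"
    then show "uniform_limit K (\<lambda>m v. nabla m (interpS (p m)) v)
        (\<lambda>v. deriv (\<lambda>w. freeS \<mu> (- w)) v) sequentially"
      by (intro uniform_limit_if_jointly_tendsto nabla_tendsto) auto
  qed
qed

end
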